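(* Let $\varphi\colon\Gamma\to G$ be a homomorphism of finite groups, let $\varphi_\infty\colon\Gamma\to\Gamma_{\infty,\varphi}$ be the canonical map and let $l\colon\Gamma_{\infty,\varphi}\to G$ be the canonical projection. Then the factorization $\Gamma\xrightarrow{\varphi_\infty}\Gamma_{\infty,\varphi}\xrightarrow{l}G$ of $\varphi$ is the universal initial factorization of $\varphi$ among all factorizations of $\varphi$ whose right map is subnormal; that is, $l$ is a subnormal map, and for every factorization $\varphi=s\circ\psi$ with $\psi\colon\Gamma\to S$ a homomorphism of groups and $s\colon S\to G$ a subnormal map there is a unique homomorphism $\tilde s\colon\Gamma_{\infty,\varphi}\to S$ such that $\tilde s\circ\varphi_\infty=\psi$ and $s\circ\tilde s=l$.
   Context: Composition is written right to left. A normal map (= crossed module) is a group homomorphism $n\colon M\to G$ together with a right action $m\mapsto m^g$ of $G$ on $M$ by automorphisms such that $n(m^g)=g^{-1}n(m)g$ and $m^{n(m')}=m'^{-1}mm'$ for all $m,m'\in M$, $g\in G$. Given normal maps $n\colon M\to G$ and $n'\colon M'\to G$, a normal morphism over $G$ is a homomorphism $\mu\colon M\to M'$ with $n'\circ\mu=n$ and $\mu(m^g)=\mu(m)^g$ for all $m\in M$, $g\in G$. A subnormal map $n\colon M\to G$ is a homomorphism such that there is a finite series of normal maps $n_i\colon M_{i+1}\to M_i$, $1\le i\le k$, with $M_1=G$ and $M_{k+1}=M$, whose composition $n_1\circ\cdots\circ n_k$ is $n$. The (free) normal closure of a homomorphism $\varphi\colon\Gamma\to G$ is the universal factorization $\Gamma\xrightarrow{c_\varphi}\Gamma^{\varphi}\xrightarrow{\overline{\varphi}}G$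 of $\varphi$ with $\overline{\varphi}$ a normal map: for every factorization $\varphi=n\circ\psi$ with $\psi\colon\Gamma\to M$ a homomorphism and $n\colon M\to G$ a normal map there is a unique normal morphism $u\colon\Gamma^\varphi\to M$ over $G$ with $u\circ c_\varphi=\psi$. It exists and is unique up to unique isomorphism. The normal closures tower of $\varphi$ is defined by $\Gamma_1=\Gamma_{1,\varphi}=G$, $\varphi_1=\varphi$, and inductively $\Gamma_{i+1}=\Gamma_{i+1,\varphi}=\Gamma^{\varphi_i}$ (the normal closure of $\varphi_i\colon\Gamma\to\Gamma_i$), $\varphi_{i+1}=c_{\varphi_i}\colon\Gamma\to\Gamma_{i+1}$, with normal map $\overline{\varphi_i}\colon\Gamma_{i+1}\to\Gamma_i$. Then $\Gamma_\infty=\Gamma_{\infty,\varphi}=\varprojlim\Gamma_i$ is the inverse limit of $\cdots\to\Gamma_3\to\Gamma_2\to\Gamma_1=G$, $\varphi_\infty\colon\Gamma\to\Gamma_\infty$ is the map induced by the $\varphi_i$, and $l\colon\Gamma_\infty\to\Gamma_1=G$ is the projection. *)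

theory Defs
  imports "HOL-Algebra.Algebra"
begin

definition normal_map ::
  "'m monoid \<Rightarrow> 'g monoid \<Rightarrow> ('m \<Rightarrow> 'g) \<Rightarrow> ('m \<Rightarrow> 'g \<Rightarrow> 'm) \<Rightarrow> bool"
where
  "normal_map M G n act \<longleftrightarrow>
     group M \<and> group G \<and> n \<in> hom M G \<and>
     (\<forall>g\<in>carrier G. (\<lambda>m. act m g) \<in> iso M M) \<and>
     (\<forall>m\<in>carrier M. act m \<one>\<^bsub>G\<^esub> = m) \<and>
     (\<forall>m\<in>carrier M. \<forall>g\<in>carrier G. \<forall>h\<in>carrier G.
        act m (g \<otimes>\<^bsub>G\<^esub> h) = act (act m g) h) \<and>
     (\<forall>m\<in>carrier M. \<forall>g\<in>carrier G.
        n (act m g) = inv\<^bsub>G\<^esub> g \<otimes>\<^bsub>G\<^esub> n m \<otimes>\<^bsub>G\<^esub> g) \<and>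
     (\<forall>m\<in>carrier M. \<forall>m'\<in>carrier M.
        act m (n m') = inv\<^bsub>M\<^esub> m' \<otimes>\<^bsub>M\<^esub> m \<otimes>\<^bsub>M\<^esub> m')"

definition normal_morphism ::
  "'g monoid \<Rightarrow> 'm monoid \<Rightarrow> ('m \<Rightarrow> 'g) \<Rightarrow> ('m \<Rightarrow> 'g \<Rightarrow> 'm) \<Rightarrow>
   'k monoid \<Rightarrow> ('k \<Rightarrow> 'g) \<Rightarrow> ('k \<Rightarrow> 'g \<Rightarrow> 'k) \<Rightarrow> ('m \<Rightarrow> 'k) \<Rightarrow> bool"
where
  "normal_morphism G M n act M' n' act' \<mu> \<longleftrightarrow>
     \<mu> \<in> hom M M' \<and>
     (\<forall>m\<in>carrier M. n' (\<mu> m) = n m) \<and>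
     (\<forall>m\<in>carrier M. \<forall>g\<in>carrier G. \<mu> (act m g) = act' (\<mu> m) g)"

text \<open>
  A series of normal maps from a group \<open>M\<close> to \<open>G\<close>, with composite \<open>n\<close>, in which \<open>M\<close> and
  all intermediate groups have elements in the type \<open>'v\<close>.
\<close>

inductive subnormal_series :: "'g monoid \<Rightarrow> 'v monoid \<Rightarrow> ('v \<Rightarrow> 'g) \<Rightarrow> bool"
  for G :: "'g monoid"
where
  single: "normal_map M G n act \<Longrightarrow> subnormal_series G M n"
| step: "subnormal_series G M n \<Longrightarrow> normal_map M' M n' act \<Longrightarrow> subnormal_series G M' (n \<circ> n')"

text \<open>
  A series of length \<open>k = 1\<close>, or of length \<open>k \<ge> 2\<close> with its last map \<open>n'\<close> split off, so that
  the source \<open>S\<close> and the target \<open>G\<close> need not share the type of the intermediate groups.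
  The intermediate groups of a finite series always fit, up to isomorphism, into one
  sufficiently large type, which is the type argument.
\<close>

definition subnormal_map ::
  "'v itself \<Rightarrow> 's monoid \<Rightarrow> 'g monoid \<Rightarrow> ('s \<Rightarrow> 'g) \<Rightarrow> bool"
where
  "subnormal_map (_ :: 'v itself) S G s \<longleftrightarrow>
     s \<in> hom S G \<and>
     ((\<exists>act. normal_map S G s act) \<or>
      (\<exists>(M :: 'v monoid) n n' act.
         subnormal_series G M n \<and> normal_map S M n' act \<and>
         (\<forall>x\<in>carrier S. s x = n (n' x))))"

text \<open>
  HOL cannot quantify over types inside a definition, so the normal maps \<open>M \<rightarrow> G\<close> used for
  testing universality are those with \<open>M\<close> on the type \<open>'u\<close> of \<open>C\<close>. If \<open>\<Gamma>\<close> and \<open>G\<close> are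
  countable and \<open>'u\<close> is infinite, this is the universal property for all \<open>M\<close>: for
  \<open>\<psi> : \<Gamma> \<rightarrow> M\<close> the elements \<open>\<psi>(\<gamma>)\<^sup>g\<close> generate a countable subgroup, again normal over \<open>G\<close>,
  which has an isomorphic copy on \<open>'u\<close>. Uniqueness of a map on a carrier is uniqueness
  among extensional functions.
\<close>

definition is_normal_closure ::
  "'a monoid \<Rightarrow> 'g monoid \<Rightarrow> ('a \<Rightarrow> 'g) \<Rightarrow>
   'u monoid \<Rightarrow> ('a \<Rightarrow> 'u) \<Rightarrow> ('u \<Rightarrow> 'g) \<Rightarrow> ('u \<Rightarrow> 'g \<Rightarrow> 'u) \<Rightarrow> bool"
where
  "is_normal_closure \<Gamma> G \<phi> C c nbar act \<longleftrightarrow>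
     c \<in> hom \<Gamma> C \<and> normal_map C G nbar act \<and>
     (\<forall>\<gamma>\<in>carrier \<Gamma>. nbar (c \<gamma>) = \<phi> \<gamma>) \<and>
     (\<forall>(M :: 'u monoid) n act' \<psi>.
        normal_map M G n act' \<and> \<psi> \<in> hom \<Gamma> M \<and> (\<forall>\<gamma>\<in>carrier \<Gamma>. n (\<psi> \<gamma>) = \<phi> \<gamma>) \<longrightarrow>
        (\<exists>!u. u \<in> extensional (carrier C) \<and>
              normal_morphism G C nbar act M n act' u \<and>
              (\<forall>\<gamma>\<in>carrier \<Gamma>. u (c \<gamma>) = \<psi> \<gamma>)))"

text \<open>
  \<open>\<Gamma>\<^sub>1 = G\<close> and \<open>\<phi>\<^sub>1 = \<phi>\<close> are kept apart from the later stages because \<open>G\<close> may live on another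
  type: for \<open>i \<ge> 2\<close>, \<open>T i\<close> is \<open>\<Gamma>\<^sub>i\<close>, \<open>f i : \<Gamma> \<rightarrow> \<Gamma>\<^sub>i\<close> is \<open>\<phi>\<^sub>i\<close>, and \<open>p i : \<Gamma>\<^sub>i\<^sub>+\<^sub>1 \<rightarrow> \<Gamma>\<^sub>i\<close> is the
  normal map of the closure of \<open>\<phi>\<^sub>i\<close>; \<open>p1 : \<Gamma>\<^sub>2 \<rightarrow> G\<close> is that of the closure of \<open>\<phi>\<close>.
  The values of \<open>T\<close>, \<open>f\<close>, \<open>p\<close> at 0 and 1 are irrelevant.
\<close>

definition normal_closures_tower ::
  "'a monoid \<Rightarrow> 'g monoid \<Rightarrow> ('a \<Rightarrow> 'g) \<Rightarrow>
   (nat \<Rightarrow> 'u monoid) \<Rightarrow> (nat \<Rightarrow> 'a \<Rightarrow> 'u) \<Rightarrow> ('u \<Rightarrow> 'g) \<Rightarrow> (nat \<Rightarrow> 'u \<Rightarrow> 'u) \<Rightarrow> bool"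
where
  "normal_closures_tower \<Gamma> G \<phi> T f p1 p \<longleftrightarrow>
     (\<exists>act. is_normal_closure \<Gamma> G \<phi> (T 2) (f 2) p1 act) \<and>
     (\<forall>i\<ge>2. \<exists>act. is_normal_closure \<Gamma> (T i) (f i) (T (Suc i)) (f (Suc i)) (p i) act)"

definition tower_limit ::
  "'g monoid \<Rightarrow> (nat \<Rightarrow> 'u monoid) \<Rightarrow> ('u \<Rightarrow> 'g) \<Rightarrow> (nat \<Rightarrow> 'u \<Rightarrow> 'u) \<Rightarrow>
   ('g \<times> (nat \<Rightarrow> 'u)) monoid"
where
  "tower_limit G T p1 p =
     (G \<times>\<times> product_group {2..} T)
       \<lparr>carrier := {(g, x). g \<in> carrier G \<and> x \<in> (\<Pi>\<^sub>E i\<in>{2..}. carrier (T i)) \<and>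
                            p1 (x 2) = g \<and> (\<forall>i\<ge>2. p i (x (Suc i)) = x i)}\<rparr>"

definition tower_map ::
  "('a \<Rightarrow> 'g) \<Rightarrow> (nat \<Rightarrow> 'a \<Rightarrow> 'u) \<Rightarrow> 'a \<Rightarrow> 'g \<times> (nat \<Rightarrow> 'u)"
where
  "tower_map \<phi> f \<gamma> = (\<phi> \<gamma>, \<lambda>i\<in>{2..}. f i \<gamma>)"

definition tower_proj :: "'g \<times> (nat \<Rightarrow> 'u) \<Rightarrow> 'g" where
  "tower_proj = fst"

end

theory Submission
  imports Defs
begin

text \<open>
  Existence of the map out of \<open>\<Gamma>\<^sub>\<infinity>\<close> is formal. Given a series of normal maps from \<open>S\<close> down to \<open>G\<close>
  and a lift \<open>\<psi> : \<Gamma> \<rightarrow> S\<close> of \<open>\<phi>\<close>, the universal property of the normal closure, applied to pullbacks,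
  lifts one stage of the tower through one map of the series at a time
  (\<open>subnormal_map_lift_exists\<close>). The rest depends on finiteness.

  All \<open>\<Gamma>\<^sub>i\<close> are finite. By uniqueness in the universal property \<open>\<Gamma>\<^sub>i\<^sub>+\<^sub>1\<close> is generated by the finitely
  many elements \<open>\<phi>\<^sub>i\<^sub>+\<^sub>1(\<gamma>)\<^sup>g\<close>. They have finite order, and the identity \<open>m\<^sup>n\<^sup>(\<^sup>m\<^sup>'\<^sup>) = m'\<^sup>-\<^sup>1 m m'\<close> says that they
  are permuted by conjugation, so Dietzmann's lemma applies. The same remark replaces test objects on
  other types by finite groups, which have copies on the type of the tower.

  The tower need not become stationary: for the trivial homomorphism from \<open>\<int>/2\<close> to \<open>\<int>/2\<close>, every
  \<open>\<Gamma>\<^sub>i\<close> with \<open>i \<ge> 2\<close> is a Klein four-group, and every map \<open>\<Gamma>\<^sub>i\<^sub>+\<^sub>1 \<rightarrow> \<Gamma>\<^sub>i\<close> with \<open>i \<ge> 2\<close> has image of order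
  two. The limit only sees the stable images \<open>L\<^sub>i = \<Inter>\<^sub>j im(\<Gamma>\<^sub>j \<rightarrow> \<Gamma>\<^sub>i)\<close>. The image of \<open>\<Gamma>\<^sub>j\<^sub>+\<^sub>1\<close> in \<open>\<Gamma>\<^sub>i\<close> is the
  normal closure of \<open>\<phi>\<^sub>i(\<Gamma>)\<close> in the image of \<open>\<Gamma>\<^sub>j\<close>. So \<open>L\<^sub>i\<close> is subnormal in \<open>\<Gamma>\<^sub>i\<close>, the normal
  closure of \<open>\<phi>\<^sub>i(\<Gamma>)\<close> in \<open>L\<^sub>i\<close> is \<open>L\<^sub>i\<close>, and \<open>L\<^sub>i\<^sub>+\<^sub>1 \<rightarrow> L\<^sub>i\<close> is onto. Its kernel is central, since
  kernels of normal maps are.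

  Such a tower of central extensions has bounded orders (\<open>central_tower_stabilises\<close>). Let \<open>K\<close> be the
  kernel of \<open>L\<^sub>i \<rightarrow> L\<^sub>0\<close>, with \<open>L\<^sub>0\<close> the first group of the tower, and let \<open>p\<close> be a prime. As \<open>K\<close> is
  hypercentral, elements of \<open>K\<close> commute with all elements of \<open>L\<^sub>i\<close> of coprime order. After dividing
  out the \<open>p\<close>-regular elements of \<open>K\<close> (those of order prime to \<open>p\<close>), \<open>K\<close> becomes a \<open>p\<close>-group centralised
  by all \<open>p\<close>-regular elements of \<open>L\<^sub>i\<close>. Hence these map injectively to \<open>L\<^sub>0\<close>, and by Dietzmann's lemma
  they generate a normal subgroup of bounded order. The quotient by it is a \<open>p\<close>-group, in which a
  subgroup whose normal closure is everything is everything; so the quotient has order at most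
  \<open>|\<Gamma>|\<close>. This bounds the \<open>p\<close>-part of \<open>|K|\<close> independently of \<open>p\<close> and \<open>i\<close>, and thereby \<open>|L\<^sub>i|\<close>.

  So \<open>L\<^sub>i\<^sub>+\<^sub>1 \<rightarrow> L\<^sub>i\<close> is bijective for large \<open>i\<close>, \<open>\<Gamma>\<^sub>\<infinity>\<close> is isomorphic to \<open>L\<^sub>i\<close>, and \<open>l\<close> is subnormal. Moreover
  \<open>\<Gamma>\<^sub>\<infinity>\<close> is the normal closure of \<open>\<phi>\<^sub>\<infinity>(\<Gamma>)\<close> in itself. Two lifts through a normal map differ by central
  elements, so they agree on a normal subgroup; this gives uniqueness, one normal map at a time.
\<close>

section \<open>Preliminaries on groups\<close>

context group
begin

lemma inv_mult_cancel_left: "\<lbrakk>x \<in> carrier G; y \<in> carrier G\<rbrakk> \<Longrightarrow> inv x \<otimes> (x \<otimes> y) = y"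
  by (metis inv_closed l_inv l_one m_assoc)

lemma mult_inv_cancel_left: "\<lbrakk>x \<in> carrier G; y \<in> carrier G\<rbrakk> \<Longrightarrow> x \<otimes> (inv x \<otimes> y) = y"
  by (metis inv_closed r_inv l_one m_assoc)

text \<open>With these rules the simplifier decides equality of words in free groups.\<close>

lemmas free_group_simps = m_assoc inv_mult_group inv_mult_cancel_left mult_inv_cancel_left

lemma pow_conjugate:
  assumes "x \<in> carrier G" "g \<in> carrier G"
  shows "(inv g \<otimes> x \<otimes> g) [^] (n::nat) = inv g \<otimes> x [^] n \<otimes> g"
  using assms by (induction n) (simp_all add: free_group_simps)

lemma commute_if_conjugate_fixes:
  assumes "x \<in> carrier G" "y \<in> carrier G" "inv y \<otimes> x \<otimes> y = x"
  shows "x \<otimes> y = y \<otimes> x"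
  using assms by (metis inv_closed m_assoc m_closed mult_inv_cancel_left)

lemma conjugate_fixes_if_commute:
  assumes "x \<in> carrier G" "y \<in> carrier G" "x \<otimes> y = y \<otimes> x"
  shows "inv y \<otimes> x \<otimes> y = x"
  using assms by (simp add: m_assoc inv_mult_cancel_left)

lemma normalI_conjugate:
  assumes "subgroup N G" "\<And>x g. \<lbrakk>x \<in> N; g \<in> carrier G\<rbrakk> \<Longrightarrow> inv g \<otimes> x \<otimes> g \<in> N"
  shows "N \<lhd> G"
  using assms(1) assms(2)[of _ "inv _"] by (intro normal_invI) (auto, metis inv_closed inv_inv)

lemma coprime_pow_eq_one:
  assumes "x \<in> carrier G" "x [^] (m::nat) = \<one>" "x [^] (n::nat) = \<one>" "coprime m n"
  shows "x = \<one>"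
  using assms by (metis coprime_common_divisor_nat ord_eq_1 pow_eq_id nat_dvd_1_iff_1)

end

definition normally_generates :: "'a set \<Rightarrow> ('a, 'b) monoid_scheme \<Rightarrow> bool" where
  "normally_generates S G \<longleftrightarrow> (\<forall>N. N \<lhd> G \<longrightarrow> S \<subseteq> N \<longrightarrow> N = carrier G)"

context group_hom
begin

lemma normal_preimage:
  assumes "N \<lhd> H"
  shows "{x \<in> carrier G. h x \<in> N} \<lhd> G"
proof (rule G.normalI_conjugate)
  interpret N: normal N H by fact
  show "subgroup {x \<in> carrier G. h x \<in> N} G"
    by (rule G.subgroupI) (use N.one_closed hom_one in auto)
  show "inv g \<otimes> x \<otimes> g \<in> {x \<in> carrier G. h x \<in> N}"
    if "x \<in> {x \<in> carrier G. h x \<in> N}" "g \<in> carrier G" for x g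
    using that N.inv_op_closed1[of "h g" "h x"] by simp
qed

lemma normally_generates_image:
  assumes "h ` carrier G = carrier H" "normally_generates S G" "S \<subseteq> carrier G"
  shows "normally_generates (h ` S) H"
  unfolding normally_generates_def
proof (intro allI impI)
  fix N assume N: "N \<lhd> H" "h ` S \<subseteq> N"
  have "{x \<in> carrier G. h x \<in> N} = carrier G"
    using assms(2,3) N(2) normal_preimage[OF N(1)] unfolding normally_generates_def by blast
  then have "carrier H \<subseteq> N" unfolding assms(1)[symmetric] by blast
  then show "N = carrier H" using subgroup.subset[OF normal_imp_subgroup[OF N(1)]] by blast
qed

end

section \<open>Dietzmann's lemma\<close>

context group
begin

definition word_product :: "'a list \<Rightarrow> 'a" where
  "word_product xs = foldr (\<otimes>) xs \<one>"

lemma word_product_simps [simp]: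
  "word_product [] = \<one>" "word_product (x # xs) = x \<otimes> word_product xs"
  by (simp_all add: word_product_def)

lemma word_product_closed: "set xs \<subseteq> carrier G \<Longrightarrow> word_product xs \<in> carrier G"
  by (induction xs) auto

lemma word_product_append:
  "\<lbrakk>set xs \<subseteq> carrier G; set ys \<subseteq> carrier G\<rbrakk>
    \<Longrightarrow> word_product (xs @ ys) = word_product xs \<otimes> word_product ys"
  by (induction xs) (auto simp: m_assoc word_product_closed)

lemma word_product_replicate:
  "x \<in> carrier G \<Longrightarrow> word_product (replicate n x) = x [^] n"
  by (induction n) (simp, metis nat_pow_Suc2 replicate_Suc word_product_simps(2))

lemma word_product_conjugate:
  "\<lbrakk>set xs \<subseteq> carrier G; g \<in> carrier G\<rbrakk>
    \<Longrightarrow> word_product xs \<otimes> g = g \<otimes> word_product (map (\<lambda>x. inv g \<otimes> x \<otimes> g) xs)"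
proof (induction xs)
  case (Cons x xs)
  let ?c = "\<lambda>x. inv g \<otimes> x \<otimes> g"
  have c: "x \<in> carrier G" "word_product xs \<in> carrier G" "word_product (map ?c xs) \<in> carrier G"
    using Cons.prems by (auto intro!: word_product_closed m_closed simp: subset_iff)
  have "word_product (x # xs) \<otimes> g = x \<otimes> (g \<otimes> word_product (map ?c xs))"
    using Cons c by (simp add: m_assoc)
  also have "\<dots> = g \<otimes> word_product (map ?c (x # xs))"
    using c Cons.prems by (simp add: m_assoc mult_inv_cancel_left)
  finally show ?case .
qed simp

text \<open>An occurrence of \<open>x\<close> moves to the front of a word at the price of conjugating the letters it
  passes by \<open>x\<close>; the other occurrences of \<open>x\<close> survive this.\<close>

lemma word_product_collect_power:
  assumes "S \<subseteq> carrier G" "\<And>x y. \<lbrakk>x \<in> S; y \<in> S\<rbrakk> \<Longrightarrow> inv y \<otimes> x \<otimes> y \<in> S"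
    and "x \<in> S" "set xs \<subseteq> S" "n \<le> count_list xs x"
  shows "\<exists>ys. set ys \<subseteq> S \<and> length ys + n = length xs \<and>
              word_product xs = x [^] n \<otimes> word_product ys"
  using assms(4,5)
proof (induction n arbitrary: xs)
  case 0
  then show ?case using assms(1)
    by (intro exI[of _ xs]) (simp add: word_product_closed subset_trans)
next
  case (Suc n)
  then have "x \<in> set xs" by (metis count_notin not_less_eq_eq zero_le)
  then obtain as bs where xs: "xs = as @ x # bs" by (meson split_list)
  let ?c = "\<lambda>y. inv x \<otimes> y \<otimes> x"
  let ?ys = "map ?c as @ bs"
  have x: "x \<in> carrier G" using assms(1,3) by blast
  have c: "set as \<subseteq> carrier G" "set bs \<subseteq> carrier G" "set (map ?c as) \<subseteq> carrier G"
    using Suc.prems xs assms(1) x by auto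
  have "count_list as x \<le> count_list (map ?c as) x"
    using x by (induction as) (auto simp: inv_mult_cancel_left m_assoc)
  then have cnt: "n \<le> count_list ?ys x" using Suc.prems xs by simp
  have "set ?ys \<subseteq> S" using Suc.prems xs assms(2,3) by auto
  from Suc.IH[OF this cnt] obtain ys where ys: "set ys \<subseteq> S" "length ys + n = length ?ys"
    "word_product ?ys = x [^] n \<otimes> word_product ys" by blast
  have "word_product xs = x \<otimes> word_product ?ys"
  proof -
    have "word_product xs = (word_product as \<otimes> x) \<otimes> word_product bs"
      using c x unfolding xs by (simp add: word_product_append m_assoc word_product_closed)
    also have "\<dots> = x \<otimes> word_product ?ys"
      using c x
      by (simp add: word_product_append word_product_conjugate[OF c(1) x] m_assoc word_product_closed)
    finally show ?thesis .
  qed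
  also have "\<dots> = x [^] Suc n \<otimes> word_product ys"
    using ys x assms(1)
    by (subst nat_pow_Suc2) (simp_all add: m_assoc word_product_closed subset_trans)
  finally show ?case using ys xs by auto
qed

lemma word_product_shorten:
  assumes "finite S" "S \<subseteq> carrier G" "\<And>x y. \<lbrakk>x \<in> S; y \<in> S\<rbrakk> \<Longrightarrow> inv y \<otimes> x \<otimes> y \<in> S"
    and "0 < m" "\<And>x. x \<in> S \<Longrightarrow> x [^] (m::nat) = \<one>"
    and "set xs \<subseteq> S"
  shows "\<exists>ys. set ys \<subseteq> S \<and> length ys \<le> m * card S \<and> word_product xs = word_product ys"
  using assms(6)
proof (induction "length xs" arbitrary: xs rule: less_induct)
  case less
  show ?case
  proof (cases "length xs \<le> m * card S")
    case True
    then show ?thesis using less.prems by blast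
  next
    case False
    have "\<exists>x\<in>S. m \<le> count_list xs x"
    proof (rule ccontr)
      assume "\<not> ?thesis"
      then have "(\<Sum>x\<in>S. count_list xs x) \<le> (\<Sum>x\<in>S. m)" by (intro sum_mono) force
      with False sum_count_set[OF less.prems assms(1)] show False by (simp add: mult.commute)
    qed
    then obtain x where x: "x \<in> S" "m \<le> count_list xs x" by blast
    obtain ys where ys: "set ys \<subseteq> S" "length ys + m = length xs"
      "word_product xs = x [^] m \<otimes> word_product ys"
      using word_product_collect_power[OF assms(2,3) x(1) less.prems x(2)] by blast
    then have "word_product xs = word_product ys"
      using assms(2,5) x by (simp add: word_product_closed subset_trans)
    moreover have "length ys < length xs" using ys assms(4) by linarith
    ultimately show ?thesis using less.hyps[OF _ ys(1)] by auto
  qed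
qed

text \<open>Since \<open>x\<^sup>-\<^sup>1 = x\<^sup>m\<^sup>-\<^sup>1\<close>, every element of the generated subgroup is the product of a word over
  \<open>S\<close>. A word with \<open>m\<close> equal letters is shortened by collecting these letters at the front, and a
  word longer than \<open>m |S|\<close> has \<open>m\<close> equal letters.\<close>

theorem dietzmann:
  assumes "finite S" "S \<subseteq> carrier G" "\<And>x y. \<lbrakk>x \<in> S; y \<in> S\<rbrakk> \<Longrightarrow> inv y \<otimes> x \<otimes> y \<in> S"
    and "0 < m" "\<And>x. x \<in> S \<Longrightarrow> x [^] (m::nat) = \<one>"
  shows "finite (generate G S)" "card (generate G S) \<le> (\<Sum>i\<le>m * card S. card S ^ i)"
proof -
  let ?W = "{xs. set xs \<subseteq> S \<and> length xs \<le> m * card S}"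
  have "\<exists>xs. set xs \<subseteq> S \<and> g = word_product xs" if "g \<in> generate G S" for g
    using that
  proof (induction rule: generate.induct)
    case one
    show ?case by (intro exI[of _ "[]"]) simp
  next
    case (incl h)
    then show ?case using assms(2) by (intro exI[of _ "[h]"]) auto
  next
    case (inv h)
    then have h: "h \<in> carrier G" using assms(2) by blast
    have "h [^] (m - 1) \<otimes> h = \<one>"
      using assms(4,5) inv by (metis Suc_diff_1 nat_pow_Suc)
    then have "inv h = h [^] (m - 1)" using h by (simp add: inv_equality)
    then show ?case using h inv
      by (intro exI[of _ "replicate (m - 1) h"]) (auto simp: word_product_replicate)
  next
    case (eng h1 h2)
    then obtain xs ys where "set xs \<subseteq> S" "h1 = word_product xs" "set ys \<subseteq> S" "h2 = word_product ys"
      by blast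
    then show ?case using assms(2)
      by (intro exI[of _ "xs @ ys"]) (simp add: word_product_append subset_trans)
  qed
  then have sub: "generate G S \<subseteq> word_product ` ?W"
    using word_product_shorten[OF assms] by fastforce
  have fin: "finite ?W" using finite_lists_length_le[OF assms(1)] by simp
  show "finite (generate G S)" using sub fin finite_surj by blast
  have "card (generate G S) \<le> card ?W" using surj_card_le[OF fin sub] .
  then show "card (generate G S) \<le> (\<Sum>i\<le>m * card S. card S ^ i)"
    using card_lists_length_le[OF assms(1)] by simp
qed

end

section \<open>Groups of prime power order\<close>

context group_action
begin

lemma card_fixed_points_mod_prime:
  assumes "Factorial_Ring.prime (p::nat)" "order G = p ^ n" "finite E"
  shows "card E mod p = card {x \<in> E. \<forall>g\<in>carrier G. \<phi> g x = x} mod p"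
proof -
  interpret group G using group_hom group_hom.axioms(1) by blast
  let ?F = "{x \<in> E. \<forall>g\<in>carrier G. \<phi> g x = x}"
  let ?f = "\<lambda>x. if x \<in> ?F then 1 else (0::nat)"
  have fo: "finite (orbits G E \<phi>)" using assms(3) unfolding orbits_def by simp
  have fin: "finite orb" if "orb \<in> orbits G E \<phi>" for orb
    using that orbits_coverture assms(3) finite_subset[of orb E] by blast
  have orb: "card orb mod p = (\<Sum>x\<in>orb. ?f x) mod p" if h: "orb \<in> orbits G E \<phi>" for orb
  proof -
    obtain x where x: "x \<in> E" "orb = orbit G \<phi> x" using h unfolding orbits_def by blast
    have xo: "x \<in> orb" using orbit_refl x by auto
    show ?thesis
    proof (cases "card orb = 1")
      case True
      then have "orb = {x}" using xo by (metis card_1_singletonE singletonD)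
      moreover from this have "x \<in> ?F" using x unfolding orbit_def by auto
      ultimately show ?thesis by simp
    next
      case False
      have "card orb dvd p ^ n" using orbit_stabilizer_theorem[OF x(1)] x(2) assms(2)
        by (metis dvd_triv_left)
      then have "p dvd card orb" using False assms(1)
        by (metis divides_primepow_nat dvd_power gr0I power_0)
      moreover have "orb \<inter> ?F = {}"
      proof (rule ccontr)
        assume "orb \<inter> ?F \<noteq> {}"
        then obtain y where y: "y \<in> orb" "y \<in> ?F" by blast
        then have "y \<in> orbit G \<phi> x" "y \<in> E" using x by auto
        then have "x \<in> orbit G \<phi> y" using orbit_sym x(1) by blast
        then have "x = y" using y(2) unfolding orbit_def by auto
        then have "orb \<subseteq> {x}" using y(2) x(2) unfolding orbit_def by auto
        then have "orb = {x}" using xo by blast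
        with False show False by simp
      qed
      then have "(\<Sum>x\<in>orb. ?f x) = 0" by (intro sum.neutral) auto
      ultimately show ?thesis by simp
    qed
  qed
  have "card E mod p = (\<Sum>orb\<in>orbits G E \<phi>. card orb) mod p"
    using disjoint_sum[OF assms(3), of "\<lambda>_. 1::nat"] by simp
  also have "\<dots> = (\<Sum>orb\<in>orbits G E \<phi>. card orb mod p) mod p"
    by (rule mod_sum_eq[symmetric])
  also have "\<dots> = (\<Sum>orb\<in>orbits G E \<phi>. (\<Sum>x\<in>orb. ?f x) mod p) mod p"
    by (rule arg_cong[where f = "\<lambda>n. n mod p"], rule sum.cong[OF refl orb])
  also have "\<dots> = (\<Sum>orb\<in>orbits G E \<phi>. \<Sum>x\<in>orb. ?f x) mod p"
    by (rule mod_sum_eq)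
  also have "(\<Sum>orb\<in>orbits G E \<phi>. \<Sum>x\<in>orb. ?f x) = (\<Sum>x\<in>E. ?f x)"
    using disjoint_sum[OF assms(3), of ?f] .
  also have "\<dots> = card ?F"
    using assms(3) by (simp add: sum.If_cases Int_def)
  finally show ?thesis .
qed

end

context group
begin

lemma subgroup_acts_on_rcosets:
  assumes "subgroup M G"
  shows "group_action (G\<lparr>carrier := M\<rparr>) (rcosets M) (\<lambda>g. \<lambda>C\<in>rcosets M. C #> inv g)"
proof -
  interpret M: subgroup M G by fact
  let ?P = "G\<lparr>carrier := M\<rparr>"
  let ?\<phi> = "\<lambda>g. \<lambda>C\<in>rcosets M. C #> inv g"
  have cs: "C \<subseteq> carrier G" if "C \<in> rcosets M" for C
    using that M.rcosets_carrier[OF is_group] by blast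
  have cl: "C #> g \<in> rcosets M" if "C \<in> rcosets M" "g \<in> M" for C g
    using that by (auto simp: RCOSETS_def coset_mult_assoc M.subset)
  have "?\<phi> g \<in> Bij (rcosets M)" if g: "g \<in> M" for g
  proof -
    have "bij_betw (?\<phi> g) (rcosets M) (rcosets M)"
      using g cl cs by (intro bij_betw_byWitness[where f' = "\<lambda>C. C #> g"]) (auto simp: coset_mult_assoc)
    then show ?thesis by (simp add: Bij_def)
  qed
  moreover have "?\<phi> (g \<otimes> h) = compose (rcosets M) (?\<phi> g) (?\<phi> h)" if "g \<in> M" "h \<in> M" for g h
    using that cl cs by (intro ext) (simp add: compose_def coset_mult_assoc inv_mult_group)
  ultimately have "?\<phi> \<in> hom ?P (BijGroup (rcosets M))"
    by (intro homI) (auto simp: BijGroup_def)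
  then show ?thesis
    using group_BijGroup subgroup_imp_group[OF assms]
    by (simp add: group_action_def group_hom_def group_hom_axioms_def)
qed

text \<open>A maximal subgroup \<open>M\<close> is normal: \<open>M\<close> acts on its cosets by translation and fixes the coset
  \<open>M\<close>, so it fixes a second coset \<open>Mx\<close> because the number of fixed cosets is divisible by \<open>p\<close>; then
  \<open>x\<close> normalises \<open>M\<close>.\<close>

theorem prime_power_group_eq_if_normal_closure:
  assumes "Factorial_Ring.prime (p::nat)" "order G = p ^ n" "subgroup H G"
    and "normally_generates H G"
  shows "H = carrier G"
proof (rule ccontr)
  assume "H \<noteq> carrier G"
  have "order G > 0" using assms(1,2) by (simp add: prime_gt_0_nat)
  then have fin: "finite (carrier G)" by (simp add: order_gt_0_iff_finite)
  let ?S = "{M. subgroup M G \<and> H \<subseteq> M \<and> M \<noteq> carrier G}"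
  have "?S \<subseteq> Pow (carrier G)" using subgroup.subset by blast
  then have "finite ?S" using fin finite_subset by blast
  moreover have "H \<in> ?S" using assms(3) \<open>H \<noteq> carrier G\<close> by blast
  ultimately obtain M where M: "M \<in> ?S" and max: "\<And>M'. M' \<in> ?S \<Longrightarrow> M \<subseteq> M' \<Longrightarrow> M = M'"
    using finite_has_maximal2[of ?S H] by auto
  then have sM: "subgroup M G" by blast
  interpret M: subgroup M G by fact
  interpret act: group_action "G\<lparr>carrier := M\<rparr>" "rcosets M" "\<lambda>g. \<lambda>C\<in>rcosets M. C #> inv g"
    by (rule subgroup_acts_on_rcosets[OF sM])
  have finR: "finite (rcosets M)"
    using fin rcosets_part_G[OF sM] by (metis finite_UnionD)
  have lag: "card (rcosets M) * card M = p ^ n" using lagrange[OF sM] assms(2) by simp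
  have "card M dvd p ^ n" using lag by (metis dvd_triv_right)
  then obtain k where "order (G\<lparr>carrier := M\<rparr>) = p ^ k"
    using assms(1) divides_primepow_nat by (auto simp: order_def)
  then have "card (rcosets M) mod p =
      card {C \<in> rcosets M. \<forall>g\<in>M. (\<lambda>C\<in>rcosets M. C #> inv g) C = C} mod p"
    using act.card_fixed_points_mod_prime[OF assms(1) _ finR] by simp
  moreover define F where "F = {C \<in> rcosets M. \<forall>g\<in>M. C #> inv g = C}"
  moreover have "{C \<in> rcosets M. \<forall>g\<in>M. (\<lambda>C\<in>rcosets M. C #> inv g) C = C} = F"
    unfolding F_def by auto
  ultimately have cnt: "card (rcosets M) mod p = card F mod p" by simp
  have "card (rcosets M) \<noteq> 1"
  proof
    assume "card (rcosets M) = 1"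
    then have "card M = card (carrier G)" using lag assms(2) by (simp add: order_def)
    then have "M = carrier G" using fin M.subset by (simp add: card_subset_eq)
    with M show False by blast
  qed
  moreover have "card (rcosets M) dvd p ^ n" using lag by (metis dvd_triv_left)
  ultimately have "p dvd card (rcosets M)" using assms(1)
    by (metis divides_primepow_nat dvd_power gr0I power_0)
  then have "p dvd card F" using cnt by (simp add: dvd_eq_mod_eq_0)
  moreover have MF: "M \<in> F"
    unfolding F_def using M.subgroup_in_rcosets[OF is_group] M.m_inv_closed by (auto simp: coset_join2 sM)
  moreover have "finite F"
    unfolding F_def using finR by simp
  ultimately have "F \<noteq> {M}" using assms(1) by auto
  \<comment> \<open>\<open>F\<close> contains \<open>M\<close> and has a multiple of \<open>p\<close> elements\<close>
  then obtain C where C: "C \<in> F" "C \<noteq> M" using MF by blast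
  then obtain x where x: "x \<in> carrier G" "C = M #> x" unfolding F_def by (auto simp: RCOSETS_def)
  have "x \<notin> M" using C x sM by (auto simp: coset_join2)
  let ?N = "{g \<in> carrier G. \<forall>m\<in>M. g \<otimes> m \<otimes> inv g \<in> M}"
  \<comment> \<open>finiteness of \<open>M\<close> makes the inclusion in the definition of \<open>?N\<close> an equality, whence inverses\<close>
  have stable: "(\<lambda>m. g \<otimes> m \<otimes> inv g) ` M = M" if g: "g \<in> ?N" for g
  proof (rule card_subset_eq)
    show "finite M" using fin M.subset finite_subset by blast
    show "(\<lambda>m. g \<otimes> m \<otimes> inv g) ` M \<subseteq> M" using g by blast
    have "inj_on (\<lambda>m. g \<otimes> m \<otimes> inv g) M"
      using g by (intro inj_onI) (auto simp: M.subset[THEN subsetD])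
    then show "card ((\<lambda>m. g \<otimes> m \<otimes> inv g) ` M) = card M" by (rule card_image)
  qed
  have sN: "subgroup ?N G"
  proof (rule subgroupI)
    show "?N \<noteq> {}" using M.subset by auto
    fix a assume a: "a \<in> ?N"
    show "inv a \<in> ?N"
    proof -
      have "inv a \<otimes> m \<otimes> a \<in> M" if m: "m \<in> M" for m
      proof -
        obtain m' where "m' \<in> M" "m = a \<otimes> m' \<otimes> inv a" using stable[OF a] m by blast
        then show ?thesis using a by (simp add: free_group_simps M.subset[THEN subsetD])
      qed
      then show ?thesis using a by simp
    qed
    fix b assume b: "b \<in> ?N"
    have "a \<otimes> b \<otimes> m \<otimes> inv (a \<otimes> b) = a \<otimes> (b \<otimes> m \<otimes> inv b) \<otimes> inv a" if "m \<in> M" for m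
      using a b that by (simp add: free_group_simps M.subset[THEN subsetD])
    then show "a \<otimes> b \<in> ?N" using a b by simp
  qed auto
  have "M \<subseteq> ?N" using M.subset by auto
  moreover have "x \<in> ?N"
  proof -
    have "x \<otimes> m \<otimes> inv x \<in> M" if m: "m \<in> M" for m
    proof -
      have "M #> x #> inv (inv m) = M #> x" using C x m M.m_inv_closed unfolding F_def by blast
      then have "M #> (x \<otimes> m) = M #> x" using m x by (simp add: coset_mult_assoc M.subset)
      then have "x \<otimes> m \<in> M #> x" using rcos_self[OF _ sM, of "x \<otimes> m"] m x by simp
      then obtain m' where "m' \<in> M" "x \<otimes> m = m' \<otimes> x" by (auto simp: r_coset_def)
      then show ?thesis using x by (simp add: m_assoc)
    qed
    then show ?thesis using x by blast
  qed
  ultimately have "?N = carrier G" using max[of ?N] M sN \<open>x \<notin> M\<close> by blast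
  then have "M \<lhd> G" by (intro normal_invI[OF sM]) blast
  then show False using assms(4) M unfolding normally_generates_def by blast
qed

end

section \<open>Hypercentral subgroups of finite groups\<close>

text \<open>The subgroups that end a finite ascending central series of \<open>G\<close>. The commutator of \<open>b\<close> and \<open>g\<close>
  is written as \<open>b\<^sup>-\<^sup>1 b\<^sup>g\<close>.\<close>

inductive hypercentral :: "('a, 'b) monoid_scheme \<Rightarrow> 'a set \<Rightarrow> bool" for G (structure) where
  trivial: "hypercentral G {\<one>}"
| extend: "\<lbrakk>hypercentral G A; B \<lhd> G; A \<subseteq> B;
    \<And>b g. \<lbrakk>b \<in> B; g \<in> carrier G\<rbrakk> \<Longrightarrow> inv b \<otimes> (inv g \<otimes> b \<otimes> g) \<in> A\<rbrakk> \<Longrightarrow> hypercentral G B"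

text \<open>An exponent in place of the order makes this pass to homomorphic images at once. If \<open>p\<close> is
  prime, coprimality excludes the exponent 0.\<close>

definition p_regular :: "('a, 'b) monoid_scheme \<Rightarrow> nat \<Rightarrow> 'a \<Rightarrow> bool" where
  "p_regular G p x \<longleftrightarrow> (\<exists>m::nat. coprime m p \<and> x [^]\<^bsub>G\<^esub> m = \<one>\<^bsub>G\<^esub>)"

definition p_element :: "('a, 'b) monoid_scheme \<Rightarrow> nat \<Rightarrow> 'a \<Rightarrow> bool" where
  "p_element G p x \<longleftrightarrow> (\<exists>a::nat. x [^]\<^bsub>G\<^esub> (p ^ a) = \<one>\<^bsub>G\<^esub>)"

context group
begin

lemma hypercentral_normal: "hypercentral G A \<Longrightarrow> A \<lhd> G"
  by (induction rule: hypercentral.induct) (simp_all add: one_is_normal)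

lemma coset_eq_self_iff: "\<lbrakk>subgroup N G; x \<in> carrier G\<rbrakk> \<Longrightarrow> N #> x = N \<longleftrightarrow> x \<in> N"
  using coset_join1 coset_join2 subgroup.subset by metis

lemma normal_commutator_closed:
  assumes "A \<lhd> G" "a \<in> A" "g \<in> carrier G"
  shows "inv a \<otimes> (inv g \<otimes> a \<otimes> g) \<in> A"
proof -
  interpret A: normal A G by fact
  show ?thesis using assms A.inv_op_closed1 by (simp add: A.m_closed A.m_inv_closed)
qed

text \<open>Raising \<open>x\<^sup>y = xu\<close> to the power \<open>m\<close> gives \<open>u\<^sup>m = 1\<close>; rewritten as \<open>x\<^sup>-\<^sup>1 y\<^sup>-\<^sup>1 x = u y\<^sup>-\<^sup>1\<close>, it gives
  \<open>u\<^sup>n = 1\<close> in the same way.\<close>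

lemma eq_one_if_central_commutator:
  assumes "x \<in> carrier G" "y \<in> carrier G" "u \<in> carrier G" "inv y \<otimes> x \<otimes> y = x \<otimes> u"
    and "x \<otimes> u = u \<otimes> x" "y \<otimes> u = u \<otimes> y"
    and "x [^] (m::nat) = \<one>" "y [^] (n::nat) = \<one>" "coprime m n"
  shows "u = \<one>"
proof (rule coprime_pow_eq_one[OF assms(3) _ _ assms(9)])
  have "(inv y \<otimes> x \<otimes> y) [^] m = \<one>" using assms(1,2,7) by (simp add: pow_conjugate)
  then show "u [^] m = \<one>"
    using assms(1,3,5,7) by (simp add: assms(4) pow_mult_distrib)
  have "inv x \<otimes> inv y \<otimes> x = inv x \<otimes> (inv y \<otimes> x \<otimes> y) \<otimes> inv y"
    using assms(1,2) by (simp add: free_group_simps)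
  then have e: "inv x \<otimes> inv y \<otimes> x = u \<otimes> inv y"
    using assms(1,2,3) by (simp add: assms(4) free_group_simps)
  have c: "u \<otimes> inv y = inv y \<otimes> u"
    using assms(2,3,6) by (metis inv_closed inv_solve_left inv_solve_right m_assoc m_closed)
  have i: "inv y [^] n = \<one>" using assms(2,8) by (simp add: nat_pow_inv)
  have "(inv x \<otimes> inv y \<otimes> x) [^] n = \<one>" using assms(1,2) i by (simp add: pow_conjugate)
  then show "u [^] n = \<one>"
    using assms(2,3) i c by (simp add: e pow_mult_distrib)
qed

text \<open>Modulo \<open>A\<close>, the commutator of \<open>x\<close> and \<open>y\<close> is central, so its order divides those of \<open>x\<close> and
  of \<open>y\<close>: it descends through the central series.\<close>

lemma hypercentral_commute_if_coprime:
  assumes "hypercentral G A" "x \<in> carrier G" "y \<in> carrier G" "inv x \<otimes> (inv y \<otimes> x \<otimes> y) \<in> A"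
    and "x [^] (m::nat) = \<one>" "y [^] (n::nat) = \<one>" "coprime m n"
  shows "x \<otimes> y = y \<otimes> x"
  using assms(1,4)
proof (induction rule: hypercentral.induct)
  case trivial
  then have "inv x \<otimes> (inv y \<otimes> x \<otimes> y) = \<one>" by simp
  then have "inv y \<otimes> x \<otimes> y = x" using assms(2,3)
    by (metis inv_closed m_closed mult_inv_cancel_left r_one)
  then show ?case using commute_if_conjugate_fixes assms(2,3) by blast
next
  case (extend A B)
  let ?u = "inv x \<otimes> (inv y \<otimes> x \<otimes> y)"
  interpret A: normal A G using extend.hyps(1) by (rule hypercentral_normal)
  interpret Q: group "G Mod A" by (rule A.factorgroup_is_group)
  interpret q: group_hom G "G Mod A" "\<lambda>a. A #> a"
    using A.r_coset_hom_Mod by unfold_locales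
  have u: "?u \<in> carrier G" using assms(2,3) by simp
  have central: "(A #> g) \<otimes>\<^bsub>G Mod A\<^esub> (A #> ?u) = (A #> ?u) \<otimes>\<^bsub>G Mod A\<^esub> (A #> g)" if g: "g \<in> carrier G" for g
  proof -
    have "A #> (inv ?u \<otimes> (inv g \<otimes> ?u \<otimes> g)) = \<one>\<^bsub>G Mod A\<^esub>"
      using extend.hyps(4)[OF extend.prems g] A.subgroup_axioms u g
      by (simp add: coset_eq_self_iff del: q.hom_mult)
    then have "inv\<^bsub>G Mod A\<^esub> (A #> ?u) \<otimes>\<^bsub>G Mod A\<^esub>
      (inv\<^bsub>G Mod A\<^esub> (A #> g) \<otimes>\<^bsub>G Mod A\<^esub> (A #> ?u) \<otimes>\<^bsub>G Mod A\<^esub> (A #> g)) = \<one>\<^bsub>G Mod A\<^esub>"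
      using u g by (simp only: q.hom_mult q.hom_inv inv_closed m_closed)
    then have "inv\<^bsub>G Mod A\<^esub> (A #> g) \<otimes>\<^bsub>G Mod A\<^esub> (A #> ?u) \<otimes>\<^bsub>G Mod A\<^esub> (A #> g) = A #> ?u"
      using u g q.hom_closed
      by (metis Q.inv_closed Q.m_closed Q.mult_inv_cancel_left Q.r_one)
    then show ?thesis using Q.commute_if_conjugate_fixes u g q.hom_closed by metis
  qed
  have "inv y \<otimes> x \<otimes> y = x \<otimes> ?u" using assms(2,3) by (simp add: mult_inv_cancel_left)
  then have e: "inv\<^bsub>G Mod A\<^esub> (A #> y) \<otimes>\<^bsub>G Mod A\<^esub> (A #> x) \<otimes>\<^bsub>G Mod A\<^esub> (A #> y) = (A #> x) \<otimes>\<^bsub>G Mod A\<^esub> (A #> ?u)"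
    using assms(2,3) u by (simp only: q.hom_mult[symmetric] q.hom_inv[symmetric] inv_closed m_closed)
  have "A #> ?u = \<one>\<^bsub>G Mod A\<^esub>"
  proof (rule Q.eq_one_if_central_commutator[OF _ _ _ e])
    show "(A #> x) [^]\<^bsub>G Mod A\<^esub> m = \<one>\<^bsub>G Mod A\<^esub>" "(A #> y) [^]\<^bsub>G Mod A\<^esub> n = \<one>\<^bsub>G Mod A\<^esub>"
      using assms(2,3,5,6) q.hom_nat_pow q.hom_one by metis+
  qed (use assms(2,3,7) u central q.hom_closed in blast)+
  then have "?u \<in> A" using u A.subgroup_axioms by (simp add: coset_eq_self_iff)
  then show ?case by (rule extend.IH)
qed

text \<open>By Bezout, \<open>x\<close> is the product of two of its powers, one with exponent divisible by the
  \<open>p\<close>-part of the group order, the other with exponent divisible by the remaining factor.\<close>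

lemma p_part_decomposition:
  assumes "finite (carrier G)" "Factorial_Ring.prime (p::nat)" "x \<in> carrier G"
  obtains u v where "x = u \<otimes> v" "p_element G p u" "p_regular G p v"
    "\<And>A. \<lbrakk>subgroup A G; x \<in> A\<rbrakk> \<Longrightarrow> u \<in> A \<and> v \<in> A"
proof -
  have o0: "order G \<noteq> 0" using assms(1) order_gt_0_iff_finite by auto
  obtain m where m: "order G = p ^ multiplicity p (order G) * m" "\<not> p dvd m"
    using o0 assms(2) multiplicity_decompose'[of "order G" p] by (metis not_prime_unit)
  let ?a = "multiplicity p (order G)"
  have cop: "coprime m (p ^ ?a)" "coprime m p"
    using prime_imp_coprime[OF assms(2) m(2)] by (simp_all add: coprime_commute)
  obtain i j where ij: "p ^ ?a * i = m * j + 1"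
    using bezout_nat[of "p ^ ?a" m] cop assms(2) by (auto simp: coprime_commute coprime_iff_gcd_eq_1)
  define u where "u = inv (x [^] (m * j))"
  define v where "v = x [^] (p ^ ?a * i)"
  have x1: "x [^] order G = \<one>" using assms(3) pow_order_eq_1 by blast
  have "v = x [^] (m * j) \<otimes> x" unfolding v_def ij by simp
  then have "x = u \<otimes> v" unfolding u_def using assms(3) by (simp add: inv_mult_cancel_left)
  moreover have "u [^] (p ^ ?a) = inv (x [^] (order G * j))"
    unfolding u_def using assms(3) m(1)
    by (metis nat_pow_inv nat_pow_closed nat_pow_pow mult.assoc mult.commute)
  then have "p_element G p u"
    unfolding p_element_def using x1 assms(3) by (metis inv_one nat_pow_one nat_pow_pow)
  moreover have "v [^] m = x [^] (order G * i)"
  proof -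
    have e: "p ^ ?a * i * m = order G * i" using m(1) by (metis mult.assoc mult.commute)
    show ?thesis unfolding v_def nat_pow_pow[OF assms(3)] e ..
  qed
  then have "p_regular G p v"
    unfolding p_regular_def using x1 assms(3) cop(2) by (metis nat_pow_one nat_pow_pow)
  moreover have "u \<in> A \<and> v \<in> A" if "subgroup A G" "x \<in> A" for A
  proof -
    interpret A: subgroup A G by fact
    have "x [^] (n::nat) \<in> A" for n using that(2) by (induction n) auto
    then show ?thesis unfolding u_def v_def by simp
  qed
  ultimately show ?thesis using that by blast
qed

lemma p_regular_conjugate:
  "\<lbrakk>x \<in> carrier G; g \<in> carrier G; p_regular G p x\<rbrakk> \<Longrightarrow> p_regular G p (inv g \<otimes> x \<otimes> g)"
  unfolding p_regular_def by (auto simp: pow_conjugate)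

lemma p_regular_inv: "\<lbrakk>x \<in> carrier G; p_regular G p x\<rbrakk> \<Longrightarrow> p_regular G p (inv x)"
  unfolding p_regular_def using nat_pow_inv by fastforce

lemma p_element_regular_eq_one:
  assumes "x \<in> carrier G" "p_element G p x" "p_regular G p x"
  shows "x = \<one>"
  using assms coprime_pow_eq_one[OF assms(1)] unfolding p_element_def p_regular_def
  by (metis coprime_power_right_iff)

lemma hypercentral_commute_p_element_regular:
  assumes "hypercentral G A" "p_element G p u" "p_regular G p v" "u \<in> carrier G" "v \<in> carrier G"
    and "u \<in> A \<or> v \<in> A"
  shows "u \<otimes> v = v \<otimes> u"
proof -
  obtain a m where a: "u [^] (p ^ a) = \<one>" and m: "coprime m p" "v [^] (m::nat) = \<one>"
    using assms unfolding p_element_def p_regular_def by blast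
  have c: "coprime m (p ^ a)" "coprime (p ^ a) m" using m by (simp_all add: coprime_commute)
  from assms(6) show ?thesis
  proof
    assume "u \<in> A"
    then have "inv u \<otimes> (inv v \<otimes> u \<otimes> v) \<in> A"
      using normal_commutator_closed hypercentral_normal assms(1,5) by blast
    then show ?thesis using hypercentral_commute_if_coprime assms(1,4,5) a m(2) c(2) by blast
  next
    assume "v \<in> A"
    then have "inv v \<otimes> (inv u \<otimes> v \<otimes> u) \<in> A"
      using normal_commutator_closed hypercentral_normal assms(1,4) by blast
    then show ?thesis using hypercentral_commute_if_coprime[of A v u] assms(1,4,5) a m(2) c(1) by metis
  qed
qed

lemma p_regular_set_normal:
  assumes "A \<lhd> G" "\<And>x y. \<lbrakk>x \<in> A; y \<in> A; p_regular G p x; p_regular G p y\<rbrakk> \<Longrightarrow> p_regular G p (x \<otimes> y)"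
  shows "{a \<in> A. p_regular G p a} \<lhd> G"
proof (rule normalI_conjugate)
  interpret A: normal A G by fact
  show "subgroup {a \<in> A. p_regular G p a} G"
  proof (rule subgroupI)
    have "p_regular G p \<one>" unfolding p_regular_def by (intro exI[of _ 1]) simp
    then show "{a \<in> A. p_regular G p a} \<noteq> {}" using A.one_closed by blast
  qed (use assms A.subset p_regular_inv in auto)
  show "inv g \<otimes> x \<otimes> g \<in> {a \<in> A. p_regular G p a}"
    if "x \<in> {a \<in> A. p_regular G p a}" "g \<in> carrier G" for x g
    using that A.inv_op_closed1 p_regular_conjugate A.subset by auto
qed

text \<open>Modulo the \<open>p\<close>-regular elements of \<open>A\<close>, the commutator of two \<open>p\<close>-regular elements of \<open>B\<close> is a
  \<open>p\<close>-element that commutes with both, hence trivial.\<close>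

lemma hypercentral_p_regular_mult:
  assumes "hypercentral G A" "finite (carrier G)" "Factorial_Ring.prime (p::nat)"
    and "x \<in> A" "y \<in> A" "p_regular G p x" "p_regular G p y"
  shows "p_regular G p (x \<otimes> y)"
  using assms(1,4-)
proof (induction arbitrary: x y rule: hypercentral.induct)
  case trivial
  then show ?case by simp
next
  case (extend A B)
  define W where "W = {a \<in> A. p_regular G p a}"
  have nA: "A \<lhd> G" using extend.hyps(1) by (rule hypercentral_normal)
  interpret A: normal A G by (rule nA)
  interpret B: normal B G by (rule extend.hyps(2))
  interpret W: normal W G unfolding W_def by (rule p_regular_set_normal[OF nA extend.IH])
  interpret Q: group "G Mod W" by (rule W.factorgroup_is_group)
  interpret q: group_hom G "G Mod W" "\<lambda>a. W #> a"
    using W.r_coset_hom_Mod by unfold_locales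
  have xy: "x \<in> carrier G" "y \<in> carrier G" using extend.prems B.subset by auto
  obtain m n where mn: "coprime m p" "x [^] (m::nat) = \<one>" "coprime n p" "y [^] (n::nat) = \<one>"
    using extend.prems unfolding p_regular_def by blast
  define c where "c = inv x \<otimes> (inv y \<otimes> x \<otimes> y)"
  have cA: "c \<in> A" unfolding c_def using extend.hyps(4) extend.prems xy by blast
  have c: "c \<in> carrier G" unfolding c_def using xy by simp
  obtain u v where uv: "c = u \<otimes> v" "p_element G p u" "p_regular G p v" "u \<in> A" "v \<in> A"
    using p_part_decomposition[OF assms(2,3) c] A.subgroup_axioms cA by metis
  have uvG: "u \<in> carrier G" "v \<in> carrier G" using uv A.subset by auto
  have "v \<in> W" using uv unfolding W_def by blast
  have comm: "x \<otimes> u = u \<otimes> x"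
    using hypercentral_commute_p_element_regular[OF extend.hyps(1) uv(2) extend.prems(3)] uv uvG xy
    by metis
  have "inv y \<otimes> x \<otimes> y = x \<otimes> u \<otimes> v"
    using xy uvG uv(1)[symmetric] unfolding c_def by (simp add: m_assoc mult_inv_cancel_left)
  then have "W #> (inv y \<otimes> x \<otimes> y) = (W #> (x \<otimes> u)) \<otimes>\<^bsub>G Mod W\<^esub> (W #> v)"
    using xy uvG q.hom_mult by (metis m_closed)
  also have "W #> v = \<one>\<^bsub>G Mod W\<^esub>"
    using \<open>v \<in> W\<close> uvG W.subgroup_axioms by (simp add: coset_eq_self_iff)
  finally have e: "W #> (inv y \<otimes> x \<otimes> y) = W #> (x \<otimes> u)"
    using xy uvG q.hom_closed Q.r_one by (metis m_closed)
  have "W #> u [^] m = W #> (x \<otimes> u) [^] m"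
    using xy uvG comm mn by (simp add: pow_mult_distrib)
  also have "\<dots> = W #> (inv y \<otimes> x \<otimes> y) [^] m"
    using e xy uvG q.hom_nat_pow by (metis inv_closed m_closed)
  also have "\<dots> = W #> \<one>" using xy mn by (simp add: pow_conjugate)
  finally have "u [^] m \<in> W"
    using uvG W.subgroup_axioms by (metis W.subset coset_mult_one coset_eq_self_iff nat_pow_closed)
  then have "p_regular G p (u [^] m)" unfolding W_def by blast
  then have "p_regular G p u"
    using uvG mn(1) unfolding p_regular_def by (metis coprime_mult_left_iff nat_pow_pow)
  then have "u = \<one>" using p_element_regular_eq_one uv uvG by blast
  then have "c \<in> W" using uv \<open>v \<in> W\<close> uvG by simp
  then have "(W #> x) \<otimes>\<^bsub>G Mod W\<^esub> (W #> c) = W #> x"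
    using c xy W.subgroup_axioms coset_eq_self_iff[of W c] Q.r_one[of "W #> x"] q.hom_closed[of x] by simp
  moreover have "y \<otimes> (x \<otimes> c) = x \<otimes> y"
    using xy unfolding c_def by (simp add: mult_inv_cancel_left m_assoc)
  ultimately have qc: "(W #> x) \<otimes>\<^bsub>G Mod W\<^esub> (W #> y) = (W #> y) \<otimes>\<^bsub>G Mod W\<^esub> (W #> x)"
    using xy c q.hom_mult by (metis m_closed)
  have "W #> (x \<otimes> y) [^] (m * n) = ((W #> x) \<otimes>\<^bsub>G Mod W\<^esub> (W #> y)) [^]\<^bsub>G Mod W\<^esub> (m * n)"
    using xy q.hom_nat_pow q.hom_mult by (metis m_closed)
  also have "\<dots> = (W #> x) [^]\<^bsub>G Mod W\<^esub> (m * n) \<otimes>\<^bsub>G Mod W\<^esub> (W #> y) [^]\<^bsub>G Mod W\<^esub> (m * n)"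
    by (rule Q.pow_mult_distrib[OF qc]) (use xy q.hom_closed in blast)+
  also have "\<dots> = (W #> x [^] (m * n)) \<otimes>\<^bsub>G Mod W\<^esub> (W #> y [^] (m * n))"
    using xy q.hom_nat_pow by metis
  also have "x [^] (m * n) = \<one>" using mn xy by (metis nat_pow_one nat_pow_pow)
  also have "y [^] (m * n) = \<one>" using mn xy by (metis mult.commute nat_pow_one nat_pow_pow)
  finally have "(x \<otimes> y) [^] (m * n) \<in> W"
    using xy W.subgroup_axioms q.hom_one Q.l_one[OF Q.one_closed]
    by (metis coset_eq_self_iff m_closed nat_pow_closed one_FactGroup)
  then have "p_regular G p ((x \<otimes> y) [^] (m * n))" unfolding W_def by blast
  then show ?case
    using xy mn unfolding p_regular_def by (metis coprime_mult_left_iff nat_pow_pow m_closed)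
qed

lemma cauchy:
  assumes "finite (carrier G)" "Factorial_Ring.prime (p::nat)" "p dvd order G"
  obtains x where "x \<in> carrier G" "x \<noteq> \<one>" "x [^] p = \<one>"
proof -
  obtain S where S: "subgroup S G" "card S = p"
    using sylow_thm[OF assms(2) is_group, of 1] assms by (metis dvdE power_one_right)
  interpret S: group "G\<lparr>carrier := S\<rparr>" using S(1) by (rule subgroup_imp_group)
  have "S \<noteq> {\<one>}" using S(2) assms(2) by auto
  then obtain x where x: "x \<in> S" "x \<noteq> \<one>" using subgroup.one_closed[OF S(1)] by blast
  have "x [^]\<^bsub>G\<lparr>carrier := S\<rparr>\<^esub> card S = \<one>" using S.pow_order_eq_1[of x] x by (simp add: order_def)
  then have "x [^] p = \<one>" using S(2) by (simp add: nat_pow_consistent[symmetric])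
  then show thesis using that x subgroup.subset[OF S(1)] by blast
qed

end

section \<open>Bounding hypercentral extensions\<close>

text \<open>Dietzmann's bound for at most \<open>g\<close> generators of exponent \<open>g\<close>.\<close>

definition dietzmann_bound :: "nat \<Rightarrow> nat" where
  "dietzmann_bound g = (\<Sum>i\<le>g * g. g ^ i)"

lemma prime_power_if_only_prime_divisor:
  assumes "(n::nat) > 0" "\<And>q. \<lbrakk>Factorial_Ring.prime q; q dvd n\<rbrakk> \<Longrightarrow> q = p"
  shows "\<exists>k. n = p ^ k"
  using assms
proof (induction n rule: less_induct)
  case (less n)
  show ?case
  proof (cases "n = 1")
    case True
    then show ?thesis by (intro exI[of _ 0]) simp
  next
    case False
    then obtain q where q: "Factorial_Ring.prime q" "q dvd n" using prime_factor_nat by blast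
    then have "q = p" using less.prems(2) by blast
    obtain m where m: "n = p * m" using q \<open>q = p\<close> by blast
    then have "m < n" "0 < m" using less.prems(1) q \<open>q = p\<close> prime_gt_1_nat[of p] by auto
    moreover have "r = p" if "Factorial_Ring.prime r" "r dvd m" for r using that less.prems(2) m by simp
    ultimately obtain k where "m = p ^ k" using less.IH by blast
    then show ?thesis using m by (intro exI[of _ "Suc k"]) simp
  qed
qed

context group
begin

lemma order_Mod_times_card: "N \<lhd> G \<Longrightarrow> order (G Mod N) * card N = order G"
  using lagrange normal_imp_subgroup unfolding order_def FactGroup_def by fastforce

text \<open>For a prime \<open>r \<noteq> p\<close>, the \<open>r\<close>-part of an element is \<open>p\<close>-regular and dies in the quotient, so the
  quotient has no elements of order \<open>r\<close>.\<close>

lemma order_Mod_generate_p_regular: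
  assumes "finite (carrier G)" "Factorial_Ring.prime (p::nat)" "D \<lhd> G"
    and "\<And>x. \<lbrakk>x \<in> carrier G; p_regular G p x\<rbrakk> \<Longrightarrow> x \<in> D"
  shows "\<exists>k. order (G Mod D) = p ^ k"
proof (rule prime_power_if_only_prime_divisor)
  interpret D: normal D G by fact
  interpret Q: group "G Mod D" by (rule D.factorgroup_is_group)
  interpret q: group_hom G "G Mod D" "\<lambda>a. D #> a"
    using D.r_coset_hom_Mod by unfold_locales
  have finQ: "finite (carrier (G Mod D))" using assms(1) by (simp add: carrier_FactGroup)
  then show "0 < order (G Mod D)" by (simp add: Q.order_gt_0_iff_finite)
  fix r assume r: "Factorial_Ring.prime r" "r dvd order (G Mod D)"
  show "r = p"
  proof (rule ccontr)
    assume "r \<noteq> p"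
    obtain y where y: "y \<in> carrier (G Mod D)" "y \<noteq> \<one>\<^bsub>G Mod D\<^esub>" "y [^]\<^bsub>G Mod D\<^esub> r = \<one>\<^bsub>G Mod D\<^esub>"
      using Q.cauchy[OF finQ r] by blast
    obtain x where x: "x \<in> carrier G" "y = D #> x" using y(1) by (auto simp: carrier_FactGroup)
    obtain u v where uv: "x = u \<otimes> v" "p_element G r u" "p_regular G r v" "u \<in> carrier G" "v \<in> carrier G"
      using p_part_decomposition[OF assms(1) r(1) x(1)] x(1) subgroup_self by metis
    have "coprime r p" using r(1) assms(2) \<open>r \<noteq> p\<close> by (simp add: primes_coprime)
    then have "p_regular G p u" using uv(2) unfolding p_element_def p_regular_def
      by (metis coprime_power_left_iff)
    then have "D #> u = \<one>\<^bsub>G Mod D\<^esub>"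
      using assms(4) uv D.subgroup_axioms by (simp add: coset_eq_self_iff)
    then have yv: "y = D #> v" using x uv q.hom_mult q.hom_closed Q.l_one by metis
    obtain m where m: "coprime m r" "v [^] (m::nat) = \<one>" using uv unfolding p_regular_def by blast
    have "y [^]\<^bsub>G Mod D\<^esub> m = \<one>\<^bsub>G Mod D\<^esub>" using yv m uv q.hom_nat_pow q.hom_one by metis
    then show False using Q.coprime_pow_eq_one[OF y(1) _ y(3) m(1)] y(2) by blast
  qed
qed

text \<open>Because the kernel is a \<open>p\<close>-group centralised by the \<open>p\<close>-regular elements, \<open>h\<close> is injective on
  them, and \<open>x\<^sup>|\<^sup>E\<^sup>| = 1\<close> for each \<open>p\<close>-regular \<open>x\<close>. By Dietzmann's lemma they generate a normal
  subgroup \<open>D\<close> whose order is bounded in terms of \<open>|E|\<close>. The quotient by \<open>D\<close> is a \<open>p\<close>-group, and there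
  normal generation by the image of \<open>H\<close> means that \<open>H\<close> maps onto it.\<close>

lemma order_le_if_p_kernel:
  assumes fin: "finite (carrier G)" and p: "Factorial_Ring.prime (p::nat)"
    and h: "group_hom G E h" and finE: "finite (carrier E)"
    and pk: "\<And>k. \<lbrakk>k \<in> carrier G; h k = \<one>\<^bsub>E\<^esub>\<rbrakk> \<Longrightarrow> p_element G p k"
    and cent: "\<And>k y. \<lbrakk>k \<in> carrier G; h k = \<one>\<^bsub>E\<^esub>; y \<in> carrier G; p_regular G p y\<rbrakk> \<Longrightarrow> k \<otimes> y = y \<otimes> k"
    and H: "subgroup H G" "normally_generates H G"
  shows "order G \<le> card H * dietzmann_bound (order E)"
proof -
  interpret h: group_hom G E h by (rule h)
  define Y where "Y = {x \<in> carrier G. p_regular G p x}"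
  define D where "D = generate G Y"
  have Y: "Y \<subseteq> carrier G" unfolding Y_def by blast
  have oE: "0 < order E" using finE h.order_gt_0_iff_finite by blast
  have "inj_on h Y"
  proof (rule inj_onI)
    fix x y assume xy: "x \<in> Y" "y \<in> Y" "h x = h y"
    then have c: "x \<in> carrier G" "y \<in> carrier G" "p_regular G p x" "p_regular G p y"
      unfolding Y_def by auto
    let ?k = "inv y \<otimes> x"
    have k: "?k \<in> carrier G" "h ?k = \<one>\<^bsub>E\<^esub>" using c xy(3) by simp_all
    have "?k \<otimes> y = y \<otimes> ?k" using cent k c by blast
    then have "?k \<otimes> y = x" using c by (simp add: mult_inv_cancel_left)
    then have "y \<otimes> x = x \<otimes> y" using c by (metis \<open>?k \<otimes> y = y \<otimes> ?k\<close> inv_closed k(1) m_assoc mult_inv_cancel_left)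
    then have comm: "x \<otimes> inv y = inv y \<otimes> x"
      using c by (metis inv_closed inv_solve_left inv_solve_right m_assoc m_closed)
    obtain m n where mn: "coprime m p" "x [^] (m::nat) = \<one>" "coprime n p" "inv y [^] (n::nat) = \<one>"
      using c p_regular_inv unfolding p_regular_def by blast
    have "x [^] (m * n) = \<one>" using mn(2) c by (metis nat_pow_one nat_pow_pow)
    moreover have "inv y [^] (m * n) = \<one>"
      using mn(4) c by (metis inv_closed mult.commute nat_pow_one nat_pow_pow)
    ultimately have "?k [^] (m * n) = \<one>"
      using c comm by (subst pow_mult_distrib) simp_all
    \<comment> \<open>\<open>?k\<close> lies in the kernel, so it is a \<open>p\<close>-element as well\<close>
    then have "p_regular G p ?k" using mn unfolding p_regular_def by (metis coprime_mult_left_iff)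
    then have "?k = \<one>" using p_element_regular_eq_one k pk by blast
    then show "x = y" using c by (metis inv_equality inv_inv inv_closed)
  qed
  then have cR: "card Y \<le> order E"
    unfolding order_def using finE Y h.hom_closed by (intro card_inj_on_le) auto
  have xE: "x [^] order E = \<one>" if "x \<in> Y" for x
  proof -
    have x: "x \<in> carrier G" "p_regular G p x" using that unfolding Y_def by auto
    have "h (x [^] order E) = \<one>\<^bsub>E\<^esub>" using x by (simp add: h.hom_nat_pow h.pow_order_eq_1)
    then have "p_element G p (x [^] order E)" using pk x by blast
    moreover have "p_regular G p (x [^] order E)"
      using x unfolding p_regular_def by (metis mult.commute nat_pow_one nat_pow_pow)
    ultimately show ?thesis using p_element_regular_eq_one x by blast
  qed
  have Rconj: "inv g \<otimes> x \<otimes> g \<in> Y" if "x \<in> Y" "g \<in> carrier G" for x g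
    using that p_regular_conjugate unfolding Y_def by auto
  have finR: "finite Y" using fin Y finite_subset by blast
  have "card D \<le> (\<Sum>i\<le>(order E * card Y). card Y ^ i)"
    unfolding D_def using Y by (intro dietzmann(2)[OF finR Y _ oE xE] Rconj) auto
  also have "\<dots> \<le> (\<Sum>i\<le>(order E * order E). card Y ^ i)"
    using cR by (intro sum_mono2) auto
  also have "\<dots> \<le> dietzmann_bound (order E)"
    unfolding dietzmann_bound_def using cR by (intro sum_mono power_mono) auto
  finally have cD: "card D \<le> dietzmann_bound (order E)" .
  have nD: "D \<lhd> G"
    unfolding D_def using Rconj[of _ "inv _"] by (intro normal_generateI[OF Y]) (metis inv_closed inv_inv)
  interpret D: normal D G by (rule nD)
  interpret Q: group "G Mod D" by (rule D.factorgroup_is_group)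
  interpret q: group_hom G "G Mod D" "\<lambda>a. D #> a"
    using D.r_coset_hom_Mod by unfold_locales
  have YD: "x \<in> D" if "x \<in> carrier G" "p_regular G p x" for x
    using that unfolding D_def Y_def by (intro generate.incl) simp
  obtain k where k: "order (G Mod D) = p ^ k"
    using order_Mod_generate_p_regular[OF fin p nD YD] by auto
  have "(\<lambda>a. D #> a) ` H = carrier (G Mod D)"
  proof (rule Q.prime_power_group_eq_if_normal_closure[OF p k])
    show "subgroup ((\<lambda>a. D #> a) ` H) (G Mod D)" by (rule q.subgroup_img_is_subgroup[OF H(1)])
    show "normally_generates ((\<lambda>a. D #> a) ` H) (G Mod D)"
      by (rule q.normally_generates_image[OF _ H(2) subgroup.subset[OF H(1)]])
        (simp add: carrier_FactGroup)
  qed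
  then have "order (G Mod D) \<le> card H"
    unfolding order_def using card_image_le[of H] fin subgroup.subset[OF H(1)] finite_subset by metis
  then have "order (G Mod D) * card D \<le> card H * dietzmann_bound (order E)"
    using cD by (rule mult_le_mono)
  then show ?thesis using order_Mod_times_card[OF nD] by simp
qed

text \<open>For each prime \<open>p\<close> the \<open>p\<close>-regular elements of the kernel \<open>K\<close> form a normal subgroup \<open>W\<close>, and
  \<open>G / W\<close> is as in the previous lemma, with a bound that does not depend on \<open>p\<close>. So every prime
  power dividing \<open>|K|\<close> is at most this bound.\<close>

theorem card_hypercentral_kernel_dvd:
  assumes fin: "finite (carrier G)"
    and h: "group_hom G E h" and finE: "finite (carrier E)"
    and hc: "hypercentral G (kernel G E h)"
    and H: "subgroup H G" "normally_generates H G"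
  shows "card (kernel G E h) dvd fact (card H * dietzmann_bound (order E))" (is "_ dvd fact ?B")
proof (rule multiplicity_le_imp_dvd)
  interpret h: group_hom G E h by (rule h)
  define K where "K = kernel G E h"
  have nK: "K \<lhd> G" unfolding K_def by (rule h.normal_kernel)
  interpret K: normal K G by (rule nK)
  have finK: "finite K" using fin K.subset finite_subset by blast
  show "card (kernel G E h) \<noteq> 0" using finK K.one_closed unfolding K_def[symmetric] by (metis card_0_eq empty_iff)
  fix p :: nat assume p: "Factorial_Ring.prime p"
  define W where "W = {x \<in> K. p_regular G p x}"
  have nW: "W \<lhd> G" unfolding W_def
    by (rule p_regular_set_normal[OF nK hypercentral_p_regular_mult[OF hc[folded K_def] fin p]])
  interpret W: normal W G by (rule nW)
  interpret Q: group "G Mod W" by (rule W.factorgroup_is_group)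
  interpret q: group_hom G "G Mod W" "\<lambda>a. W #> a"
    using W.r_coset_hom_Mod by unfold_locales
  have WK: "W \<subseteq> K" unfolding W_def by blast
  have finQ: "finite (carrier (G Mod W))" using fin by (simp add: carrier_FactGroup)
  have "h x = h y" if "x \<in> carrier G" "y \<in> carrier G" "W #> x = W #> y" for x y
  proof -
    have "x \<in> W #> y" using that W.subgroup_axioms rcos_self by metis
    then obtain w where "w \<in> W" "x = w \<otimes> y" by (auto simp: r_coset_def)
    then show ?thesis using WK that W.subset unfolding K_def kernel_def by auto
  qed
  then obtain e where e: "e \<in> hom (G Mod W) E" "\<And>x. x \<in> carrier G \<Longrightarrow> e (W #> x) = h x"
    using FactGroup_universal[OF h.homh nW] by metis
  have "order (G Mod W) \<le> card ((\<lambda>a. W #> a) ` H) * dietzmann_bound (order E)"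
  proof (rule Q.order_le_if_p_kernel[OF finQ p _ finE])
    show "group_hom (G Mod W) E e" using e by unfold_locales
    \<comment> \<open>the kernel of \<open>e\<close> is \<open>K / W\<close>, and \<open>W\<close> absorbs the \<open>p\<close>-regular parts\<close>
    have modp: "\<exists>u. u \<in> K \<and> p_element G p u \<and> y = W #> u"
      if y: "y \<in> carrier (G Mod W)" "e y = \<one>\<^bsub>E\<^esub>" for y
    proof -
      obtain x where x: "x \<in> carrier G" "y = W #> x" using y by (auto simp: carrier_FactGroup)
      then have "x \<in> K" using y e unfolding K_def kernel_def by auto
      then obtain u v where uv: "x = u \<otimes> v" "p_element G p u" "p_regular G p v" "u \<in> K" "v \<in> K"
        using p_part_decomposition[OF fin p x(1)] K.subgroup_axioms by metis
      then have "v \<in> W" "v \<in> carrier G" "u \<in> carrier G" unfolding W_def using K.subset by auto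
      then have "y = W #> u"
        using x uv(1) q.hom_mult[of u v] q.hom_closed[of u] Q.r_one[of "W #> u"]
          coset_eq_self_iff[OF W.subgroup_axioms, of v] by simp
      then show ?thesis using uv by blast
    qed
    show "p_element (G Mod W) p y" if y: "y \<in> carrier (G Mod W)" "e y = \<one>\<^bsub>E\<^esub>" for y
    proof -
      obtain u where u: "u \<in> K" "p_element G p u" "y = W #> u" using modp[OF y] by blast
      then show ?thesis using K.subset q.hom_nat_pow q.hom_one unfolding p_element_def by (metis subsetD)
    qed
    show "k \<otimes>\<^bsub>G Mod W\<^esub> y = y \<otimes>\<^bsub>G Mod W\<^esub> k"
      if k: "k \<in> carrier (G Mod W)" "e k = \<one>\<^bsub>E\<^esub>" and y: "y \<in> carrier (G Mod W)" "p_regular (G Mod W) p y" for k y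
    proof -
      obtain u where u: "u \<in> K" "p_element G p u" "k = W #> u" using modp[OF k] by blast
      obtain x where x: "x \<in> carrier G" "y = W #> x" using y by (auto simp: carrier_FactGroup)
      obtain m where m: "coprime m p" "y [^]\<^bsub>G Mod W\<^esub> (m::nat) = \<one>\<^bsub>G Mod W\<^esub>"
        using y(2) unfolding p_regular_def by blast
      have "W #> x [^] m = W" using m x q.hom_nat_pow by (metis one_FactGroup)
      then have "x [^] m \<in> W" using x coset_eq_self_iff[OF W.subgroup_axioms] by simp
      then have "p_regular G p (x [^] m)" unfolding W_def by blast
      then have "p_regular G p x"
        using x m(1) unfolding p_regular_def by (metis coprime_mult_left_iff nat_pow_pow)
      then have "u \<otimes> x = x \<otimes> u"
        using hypercentral_commute_p_element_regular[OF hc] u x K.subset unfolding K_def by blast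
      then show ?thesis using u x K.subset q.hom_mult by (metis subsetD)
    qed
    show "subgroup ((\<lambda>a. W #> a) ` H) (G Mod W)" by (rule q.subgroup_img_is_subgroup[OF H(1)])
    show "normally_generates ((\<lambda>a. W #> a) ` H) (G Mod W)"
      by (rule q.normally_generates_image[OF _ H(2) subgroup.subset[OF H(1)]])
        (simp add: carrier_FactGroup)
  qed
  moreover have "card ((\<lambda>a. W #> a) ` H) \<le> card H"
    using card_image_le fin subgroup.subset[OF H(1)] finite_subset by metis
  ultimately have oQ: "order (G Mod W) \<le> ?B" by (meson le_trans mult_le_mono1)
  let ?GK = "G\<lparr>carrier := K\<rparr>"
  interpret GK: group ?GK using K.subgroup_axioms by (rule subgroup_imp_group)
  have sWK: "subgroup W ?GK" using subgroup_incl W.subgroup_axioms K.subgroup_axioms WK by blast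
  have "rcosets\<^bsub>?GK\<^esub> W \<subseteq> rcosets W" using K.subset by (auto simp: RCOSETS_def r_coset_def)
  then have "card (rcosets\<^bsub>?GK\<^esub> W) \<le> order (G Mod W)"
    unfolding order_def FactGroup_def using finQ by (simp add: card_mono FactGroup_def)
  then have idx: "card (rcosets\<^bsub>?GK\<^esub> W) \<le> ?B" using oQ by linarith
  have cK: "card (rcosets\<^bsub>?GK\<^esub> W) * card W = card K"
    using GK.lagrange[OF sWK] by (simp add: order_def)
  have "\<not> p dvd card W"
  proof
    assume d: "p dvd card W"
    interpret GW: group "G\<lparr>carrier := W\<rparr>" using W.subgroup_axioms by (rule subgroup_imp_group)
    obtain x where x: "x \<in> W" "x \<noteq> \<one>" "x [^]\<^bsub>G\<lparr>carrier := W\<rparr>\<^esub> p = \<one>"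
      using GW.cauchy[OF _ p] d finite_subset[OF WK finK] by (auto simp: order_def)
    have "p_element G p x" unfolding p_element_def
      using x(3) by (intro exI[of _ 1]) (simp add: nat_pow_consistent[symmetric])
    then show False using p_element_regular_eq_one[of x p] x unfolding W_def using K.subset by blast
  qed
  then have copW: "coprime (p ^ multiplicity p (card K)) (card W)"
    using p by (simp add: prime_imp_coprime)
  have "p ^ multiplicity p (card K) dvd card (rcosets\<^bsub>?GK\<^esub> W) * card W"
    unfolding cK by (rule multiplicity_dvd)
  then have d: "p ^ multiplicity p (card K) dvd card (rcosets\<^bsub>?GK\<^esub> W)"
    using copW coprime_dvd_mult_left_iff by blast
  have "card (rcosets\<^bsub>?GK\<^esub> W) > 0"
    using cK finK K.one_closed by (metis card_gt_0_iff empty_iff gr0I mult_0)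
  then have "p ^ multiplicity p (card K) \<le> ?B" using d idx by (meson dvd_imp_le le_trans)
  moreover have "p ^ multiplicity p (card K) > 0" using p by (simp add: prime_gt_0_nat)
  ultimately have "p ^ multiplicity p (card K) dvd fact ?B" by (intro dvd_fact) linarith+
  then show "multiplicity p (card (kernel G E h)) \<le> multiplicity p (fact ?B)"
    unfolding K_def using p by (intro multiplicity_geI) auto
qed

end

section \<open>Towers of central extensions\<close>

lemma (in group_hom) hypercentral_preimage:
  assumes "hypercentral H A"
    and central: "\<And>z x. \<lbrakk>z \<in> carrier G; h z = \<one>\<^bsub>H\<^esub>; x \<in> carrier G\<rbrakk> \<Longrightarrow> z \<otimes> x = x \<otimes> z"
  shows "hypercentral G {x \<in> carrier G. h x \<in> A}"
  using assms(1)
proof (induction rule: hypercentral.induct)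
  case trivial
  have "{x \<in> carrier G. h x \<in> {\<one>\<^bsub>H\<^esub>}} \<lhd> G" by (rule normal_preimage[OF H.one_is_normal])
  moreover have "inv b \<otimes> (inv g \<otimes> b \<otimes> g) = \<one>"
    if "b \<in> carrier G" "h b = \<one>\<^bsub>H\<^esub>" "g \<in> carrier G" for b g
    using G.conjugate_fixes_if_commute[OF that(1,3) central[OF that]] that by simp
  ultimately show ?case
    by (intro hypercentral.extend[OF hypercentral.trivial]) auto
next
  case (extend A B)
  have "{x \<in> carrier G. h x \<in> B} \<lhd> G" by (rule normal_preimage[OF extend.hyps(2)])
  then show ?case
    using extend.hyps by (intro hypercentral.extend[OF extend.IH]) auto
qed

lemma bounded_mono_nat_seq_eventually_constant:
  fixes a :: "nat \<Rightarrow> nat"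
  assumes "\<And>i. a i \<le> a (Suc i)" "\<And>i. a i \<le> b"
  shows "\<exists>i0. \<forall>i\<ge>i0. a (Suc i) = a i"
proof -
  obtain i0 where i0: "\<And>i. a i \<le> a i0"
    using ex_has_greatest_nat[of "\<lambda>_. True" 0 a "Suc b"] assms(2) by (auto simp: le_imp_less_Suc)
  have "a i0 \<le> a i" if "i0 \<le> i" for i using lift_Suc_mono_le[of a, OF assms(1) that] .
  then show ?thesis using i0 by (metis le_SucI le_antisym)
qed

text \<open>All kernels \<open>ker (L i \<rightarrow> L 0)\<close> are hypercentral, so their orders divide one factorial. The orders
  of the \<open>L i\<close> increase with \<open>i\<close> and are therefore eventually constant.\<close>

theorem central_tower_stabilises:
  fixes L :: "nat \<Rightarrow> ('u, 'b) monoid_scheme"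
  assumes hom: "\<And>i. group_hom (L (Suc i)) (L i) (p i)" and fin: "\<And>i. finite (carrier (L i))"
    and surj: "\<And>i. p i ` carrier (L (Suc i)) = carrier (L i)"
    and central: "\<And>i z x. \<lbrakk>z \<in> carrier (L (Suc i)); p i z = \<one>\<^bsub>L i\<^esub>; x \<in> carrier (L (Suc i))\<rbrakk>
      \<Longrightarrow> z \<otimes>\<^bsub>L (Suc i)\<^esub> x = x \<otimes>\<^bsub>L (Suc i)\<^esub> z"
    and H: "\<And>i. subgroup (H i) (L i)" "\<And>i. normally_generates (H i) (L i)" "\<And>i. card (H i) \<le> c"
  shows "\<exists>i0. \<forall>i\<ge>i0. inj_on (p i) (carrier (L (Suc i)))"
proof -
  have gr: "group (L i)" for i using hom[of i] by (simp add: group_hom_def)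
  define q where "q = rec_nat (\<lambda>x. x) (\<lambda>i qi. qi \<circ> p i)"
  have q: "q 0 = (\<lambda>x. x)" "q (Suc i) = q i \<circ> p i" for i unfolding q_def by simp_all
  have qh: "group_hom (L i) (L 0) (q i)" for i
  proof (induction i)
    case 0
    show ?case using gr by (simp add: q group_hom_def group_hom_axioms_def hom_def)
  next
    case (Suc i)
    then show ?case using hom[of i] hom_compose[of "p i" "L (Suc i)" "L i" "q i" "L 0"]
      by (simp add: q group_hom_def group_hom_axioms_def o_def)
  qed
  have qs: "q i ` carrier (L i) = carrier (L 0)" for i
  proof (induction i)
    case (Suc i)
    then show ?case unfolding q(2) by (simp only: image_comp[symmetric] surj)
  qed (simp add: q)
  have hc: "hypercentral (L i) (kernel (L i) (L 0) (q i))" for i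
  proof (induction i)
    case 0
    have "kernel (L 0) (L 0) (q 0) = {\<one>\<^bsub>L 0\<^esub>}"
      using group.is_monoid[OF gr[of 0]] monoid.one_closed by (auto simp: q kernel_def)
    then show ?case by (simp add: hypercentral.trivial)
  next
    case (Suc i)
    have "kernel (L (Suc i)) (L 0) (q (Suc i)) = {x \<in> carrier (L (Suc i)). p i x \<in> kernel (L i) (L 0) (q i)}"
      using group_hom.hom_closed[OF hom] by (auto simp: q kernel_def)
    then show ?case using group_hom.hypercentral_preimage[OF hom Suc central] by simp
  qed
  define B where "B = (fact (c * dietzmann_bound (order (L 0))) :: nat)"
  have bound: "card (carrier (L i)) \<le> order (L 0) * B" for i
  proof -
    interpret qi: group_hom "L i" "L 0" "q i" by (rule qh)
    let ?K = "kernel (L i) (L 0) (q i)"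
    have "card ?K dvd fact (card (H i) * dietzmann_bound (order (L 0)))"
      by (rule group.card_hypercentral_kernel_dvd[OF gr fin qh fin hc H(1,2)])
    also have "fact (card (H i) * dietzmann_bound (order (L 0))) dvd B"
      unfolding B_def using H(3)[of i] by (intro fact_dvd mult_le_mono1)
    finally have "card ?K \<le> B" unfolding B_def by (simp add: dvd_imp_le)
    moreover have "order (L i Mod ?K) = order (L 0)"
      using iso_same_card[OF is_isoI[OF qi.FactGroup_iso_set[OF qs]]] by (simp add: order_def)
    ultimately show ?thesis
      using qi.G.order_Mod_times_card[OF qi.normal_kernel] by (metis order_def mult_le_mono2)
  qed
  have "card (carrier (L i)) \<le> card (carrier (L (Suc i)))" for i
    using surj fin by (metis card_image_le)
  then obtain i0 where i0: "\<And>i. i \<ge> i0 \<Longrightarrow> card (carrier (L (Suc i))) = card (carrier (L i))"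
    using bounded_mono_nat_seq_eventually_constant[of "\<lambda>i. card (carrier (L i))", OF _ bound] by blast
  have "inj_on (p i) (carrier (L (Suc i)))" if "i \<ge> i0" for i
    using i0[OF that] fin surj by (intro eq_card_imp_inj_on) auto
  then show ?thesis by blast
qed

section \<open>Normal maps\<close>

text \<open>That \<open>g\<close> acts bijectively follows from the action of its inverse.\<close>

lemma normal_mapI:
  assumes "group M" "group G" "n \<in> hom M G"
    and closed: "\<And>m g. \<lbrakk>m \<in> carrier M; g \<in> carrier G\<rbrakk> \<Longrightarrow> act m g \<in> carrier M"
    and mult: "\<And>m m' g. \<lbrakk>m \<in> carrier M; m' \<in> carrier M; g \<in> carrier G\<rbrakk>
      \<Longrightarrow> act (m \<otimes>\<^bsub>M\<^esub> m') g = act m g \<otimes>\<^bsub>M\<^esub> act m' g"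
    and one: "\<And>m. m \<in> carrier M \<Longrightarrow> act m \<one>\<^bsub>G\<^esub> = m"
    and comp: "\<And>m g h. \<lbrakk>m \<in> carrier M; g \<in> carrier G; h \<in> carrier G\<rbrakk>
      \<Longrightarrow> act m (g \<otimes>\<^bsub>G\<^esub> h) = act (act m g) h"
    and equivariant: "\<And>m g. \<lbrakk>m \<in> carrier M; g \<in> carrier G\<rbrakk>
      \<Longrightarrow> n (act m g) = inv\<^bsub>G\<^esub> g \<otimes>\<^bsub>G\<^esub> n m \<otimes>\<^bsub>G\<^esub> g"
    and peiffer: "\<And>m m'. \<lbrakk>m \<in> carrier M; m' \<in> carrier M\<rbrakk>
      \<Longrightarrow> act m (n m') = inv\<^bsub>M\<^esub> m' \<otimes>\<^bsub>M\<^esub> m \<otimes>\<^bsub>M\<^esub> m'"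
  shows "normal_map M G n act"
proof -
  interpret G: group G by fact
  have iso: "(\<lambda>m. act m g) \<in> iso M M" if g: "g \<in> carrier G" for g
  proof (rule isoI)
    show "(\<lambda>m. act m g) \<in> hom M M" using g closed mult by (intro homI) auto
    have "act (act m g) (inv\<^bsub>G\<^esub> g) = m" "act (act m (inv\<^bsub>G\<^esub> g)) g = m" if "m \<in> carrier M" for m
      using that g by (metis comp one G.r_inv G.inv_closed, metis comp one G.l_inv G.inv_closed)
    then show "bij_betw (\<lambda>m. act m g) (carrier M) (carrier M)"
      using closed[OF _ g] closed[OF _ G.inv_closed[OF g]]
      by (intro bij_betw_byWitness[where f' = "\<lambda>m. act m (inv\<^bsub>G\<^esub> g)"]) blast+
  qed
  show ?thesis unfolding normal_map_def by (intro conjI ballI iso assms)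
qed

locale crossed_module =
  fixes M :: "'m monoid" and G :: "'g monoid" and n :: "'m \<Rightarrow> 'g" and act :: "'m \<Rightarrow> 'g \<Rightarrow> 'm"
  assumes normal_map: "normal_map M G n act"
begin

sublocale M: group M
  using normal_map unfolding normal_map_def by blast

sublocale G: group G
  using normal_map unfolding normal_map_def by blast

sublocale n: group_hom M G n
  using normal_map unfolding normal_map_def by unfold_locales blast

lemma act_hom: "g \<in> carrier G \<Longrightarrow> group_hom M M (\<lambda>m. act m g)"
  using normal_map M.is_group unfolding normal_map_def iso_def
  by (simp add: group_hom_def group_hom_axioms_def)

lemma act_closed [simp]: "\<lbrakk>m \<in> carrier M; g \<in> carrier G\<rbrakk> \<Longrightarrow> act m g \<in> carrier M"
  using group_hom.hom_closed[OF act_hom] by blast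

lemma act_mult: "\<lbrakk>m \<in> carrier M; m' \<in> carrier M; g \<in> carrier G\<rbrakk>
    \<Longrightarrow> act (m \<otimes>\<^bsub>M\<^esub> m') g = act m g \<otimes>\<^bsub>M\<^esub> act m' g"
  using group_hom.hom_mult[OF act_hom] by blast

lemma act_one [simp]: "m \<in> carrier M \<Longrightarrow> act m \<one>\<^bsub>G\<^esub> = m"
  using normal_map unfolding normal_map_def by blast

lemma act_comp: "\<lbrakk>m \<in> carrier M; g \<in> carrier G; h \<in> carrier G\<rbrakk>
    \<Longrightarrow> act m (g \<otimes>\<^bsub>G\<^esub> h) = act (act m g) h"
  using normal_map unfolding normal_map_def by blast

lemma equivariant: "\<lbrakk>m \<in> carrier M; g \<in> carrier G\<rbrakk>
    \<Longrightarrow> n (act m g) = inv\<^bsub>G\<^esub> g \<otimes>\<^bsub>G\<^esub> n m \<otimes>\<^bsub>G\<^esub> g"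
  using normal_map unfolding normal_map_def by blast

lemma peiffer: "\<lbrakk>m \<in> carrier M; m' \<in> carrier M\<rbrakk>
    \<Longrightarrow> act m (n m') = inv\<^bsub>M\<^esub> m' \<otimes>\<^bsub>M\<^esub> m \<otimes>\<^bsub>M\<^esub> m'"
  using normal_map unfolding normal_map_def by blast

lemma kernel_central:
  assumes "z \<in> carrier M" "n z = \<one>\<^bsub>G\<^esub>" "m \<in> carrier M"
  shows "z \<otimes>\<^bsub>M\<^esub> m = m \<otimes>\<^bsub>M\<^esub> z"
  using peiffer[OF assms(3,1)] assms M.commute_if_conjugate_fixes by (metis act_one)

lemma restrict_subgroup:
  assumes "subgroup S M" "\<And>m g. \<lbrakk>m \<in> S; g \<in> carrier G\<rbrakk> \<Longrightarrow> act m g \<in> S"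
  shows "normal_map (M\<lparr>carrier := S\<rparr>) G n act"
proof -
  interpret S: subgroup S M by fact
  show ?thesis
    using assms(2) M.subgroup_imp_group[OF assms(1)] n.homh
    by (intro normal_mapI)
      (auto simp: hom_def act_mult act_comp equivariant peiffer M.m_inv_consistent[OF assms(1)])
qed

text \<open>This moves a normal map to another type.\<close>

lemma transport:
  assumes inj: "inj_on j (carrier M)"
  defines "k \<equiv> inv_into (carrier M) j"
  shows "normal_map (image_group j M) G (n \<circ> k) (\<lambda>x g. j (act (k x) g))"
    and "j \<in> hom M (image_group j M)" "k \<in> hom (image_group j M) M"
proof -
  let ?N = "image_group j M"
  have kj: "k (j m) = m" if "m \<in> carrier M" for m
    unfolding k_def using inj that by simp
  have c: "carrier ?N = j ` carrier M" by (rule image_group_carrier)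
  have m: "x \<otimes>\<^bsub>?N\<^esub> y = j (k x \<otimes>\<^bsub>M\<^esub> k y)" for x y
    unfolding k_def image_group_def by simp
  have "weak_group_morphism j {\<one>\<^bsub>M\<^esub>} M"
    using inj by (intro weak_group_morphismsI) (auto simp: M.one_is_normal inj_on_eq_iff, metis M.inv_equality M.inv_inv M.inv_closed)
  then interpret N: group ?N by (rule M.image_group_is_group)
  show jh: "j \<in> hom M ?N" by (intro homI) (auto simp: c m kj)
  show kh: "k \<in> hom ?N M" by (intro homI) (auto simp: c m kj)
  interpret k: group_hom ?N M k using kh by unfold_locales
  show "normal_map ?N G (n \<circ> k) (\<lambda>x g. j (act (k x) g))"
  proof (rule normal_mapI)
    show "n \<circ> k \<in> hom ?N G" using hom_compose[OF kh n.homh] .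
    have jk: "j (k x) = x" if "x \<in> carrier ?N" for x using that by (auto simp: c kj)
    show "j (act (k x) ((n \<circ> k) y)) = inv\<^bsub>?N\<^esub> y \<otimes>\<^bsub>?N\<^esub> x \<otimes>\<^bsub>?N\<^esub> y"
      if "x \<in> carrier ?N" "y \<in> carrier ?N" for x y
    proof -
      have "j (act (k x) ((n \<circ> k) y)) = j (k (inv\<^bsub>?N\<^esub> y \<otimes>\<^bsub>?N\<^esub> x \<otimes>\<^bsub>?N\<^esub> y))"
        using that by (simp add: peiffer)
      also have "\<dots> = inv\<^bsub>?N\<^esub> y \<otimes>\<^bsub>?N\<^esub> x \<otimes>\<^bsub>?N\<^esub> y" using that by (intro jk) simp
      finally show ?thesis .
    qed
  qed (auto simp: c m kj act_mult act_comp equivariant)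
qed

end

text \<open>Normal maps are stable under base change along \<open>h\<close>.\<close>

lemma (in crossed_module) pullback:
  fixes B :: "'b monoid"
  assumes "group_hom B G h"
  shows "normal_map ((B \<times>\<times> M)\<lparr>carrier := {(b, m). b \<in> carrier B \<and> m \<in> carrier M \<and> h b = n m}\<rparr>) B fst
    (\<lambda>(b, m) g. (inv\<^bsub>B\<^esub> g \<otimes>\<^bsub>B\<^esub> b \<otimes>\<^bsub>B\<^esub> g, act m (h g)))" (is "normal_map (?D\<lparr>carrier := ?P\<rparr>) B _ _")
proof -
  interpret h: group_hom B G h by fact
  interpret D: group ?D by (rule DirProd_group[OF h.G.is_group M.is_group])
  have s: "subgroup ?P ?D"
  proof (rule D.subgroupI)
    have "(\<one>\<^bsub>B\<^esub>, \<one>\<^bsub>M\<^esub>) \<in> ?P" by simp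
    then show "?P \<noteq> {}" by blast
  qed (auto simp: inv_DirProd[OF h.G.is_group M.is_group])
  show ?thesis
  proof (rule normal_mapI)
    show "group (?D\<lparr>carrier := ?P\<rparr>)" by (rule D.subgroup_imp_group[OF s])
    show "group B" by (rule h.G.is_group)
    show "fst \<in> hom (?D\<lparr>carrier := ?P\<rparr>) B" by (intro homI) auto
    show "(case x of (b, m) \<Rightarrow> \<lambda>g. (inv\<^bsub>B\<^esub> g \<otimes>\<^bsub>B\<^esub> b \<otimes>\<^bsub>B\<^esub> g, act m (h g))) (fst y)
        = inv\<^bsub>?D\<lparr>carrier := ?P\<rparr>\<^esub> y \<otimes>\<^bsub>?D\<lparr>carrier := ?P\<rparr>\<^esub> x \<otimes>\<^bsub>?D\<lparr>carrier := ?P\<rparr>\<^esub> y"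
      if "x \<in> carrier (?D\<lparr>carrier := ?P\<rparr>)" "y \<in> carrier (?D\<lparr>carrier := ?P\<rparr>)" for x y
      using that s by (auto simp: D.m_inv_consistent inv_DirProd[OF h.G.is_group M.is_group] peiffer)
  qed (auto simp: act_mult act_comp equivariant h.G.free_group_simps G.m_assoc)
qed

lemma inclusion_normal_map:
  assumes "N \<lhd> G"
  shows "normal_map (G\<lparr>carrier := N\<rparr>) G (\<lambda>x. x) (\<lambda>x g. inv\<^bsub>G\<^esub> g \<otimes>\<^bsub>G\<^esub> x \<otimes>\<^bsub>G\<^esub> g)"
proof -
  interpret N: normal N G by fact
  have "inv\<^bsub>G\<^esub> g \<otimes>\<^bsub>G\<^esub> (x \<otimes>\<^bsub>G\<^esub> g) \<in> N" if "x \<in> N" "g \<in> carrier G" for x g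
    using N.inv_op_closed1[OF that(2,1)] that by (simp add: N.m_assoc)
  then show ?thesis
    by (intro normal_mapI)
      (auto simp: N.subgroup_is_group N.is_group hom_def N.free_group_simps
        N.m_inv_consistent[OF N.subgroup_axioms])
qed

text \<open>The group acts on the source of an isomorphism by transported conjugation.\<close>

lemma iso_normal_map:
  assumes "group S" "group M" "h \<in> iso S M"
  defines "k \<equiv> inv_into (carrier S) h"
  shows "normal_map S M h (\<lambda>x g. inv\<^bsub>S\<^esub> (k g) \<otimes>\<^bsub>S\<^esub> x \<otimes>\<^bsub>S\<^esub> k g)"
proof -
  interpret S: group S by fact
  interpret M: group M by fact
  interpret h: group_hom S M h using assms(3) by unfold_locales (simp add: iso_def)
  have bij: "bij_betw h (carrier S) (carrier M)" using assms(3) by (simp add: iso_def)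
  have "k \<in> iso M S" unfolding k_def by (rule S.iso_set_sym[OF assms(3)])
  then interpret k: group_hom M S k by unfold_locales (simp add: iso_def)
  have kh: "k (h x) = x" if "x \<in> carrier S" for x
    unfolding k_def using bij that by (simp add: bij_betw_def)
  have hk: "h (k y) = y" if "y \<in> carrier M" for y
    unfolding k_def using bij that by (simp add: bij_betw_def f_inv_into_f)
  show ?thesis
    by (rule normal_mapI) (auto simp: kh hk S.free_group_simps M.free_group_simps h.homh)
qed

subsection \<open>The part generated by a lift\<close>

context crossed_module
begin

definition translates :: "'a monoid \<Rightarrow> ('a \<Rightarrow> 'm) \<Rightarrow> 'm set" where
  "translates \<Gamma> \<psi> = {act (\<psi> \<gamma>) g | \<gamma> g. \<gamma> \<in> carrier \<Gamma> \<and> g \<in> carrier G}"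

context
  fixes \<Gamma> :: "'a monoid" and \<psi> :: "'a \<Rightarrow> 'm"
  assumes \<psi>: "group_hom \<Gamma> M \<psi>"
begin

interpretation \<psi>: group_hom \<Gamma> M \<psi> by (rule \<psi>)

lemma translates_subset: "translates \<Gamma> \<psi> \<subseteq> carrier M"
  unfolding translates_def by auto

lemma lift_in_translates: "\<gamma> \<in> carrier \<Gamma> \<Longrightarrow> \<psi> \<gamma> \<in> translates \<Gamma> \<psi>"
  unfolding translates_def using act_one[of "\<psi> \<gamma>"] G.one_closed \<psi>.hom_closed by force

lemma translates_act: "\<lbrakk>m \<in> translates \<Gamma> \<psi>; g \<in> carrier G\<rbrakk> \<Longrightarrow> act m g \<in> translates \<Gamma> \<psi>"
  unfolding translates_def by (auto simp: act_comp[symmetric]) (metis G.m_closed)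

lemma generated_part_normal_map:
  "normal_map (M\<lparr>carrier := generate M (translates \<Gamma> \<psi>)\<rparr>) G n act"
proof (rule restrict_subgroup[OF M.generate_is_subgroup[OF translates_subset]])
  fix m g assume m: "m \<in> generate M (translates \<Gamma> \<psi>)" and g: "g \<in> carrier G"
  interpret a: group_hom M M "\<lambda>m. act m g" by (rule act_hom[OF g])
  have "(\<lambda>m. act m g) ` generate M (translates \<Gamma> \<psi>) = generate M ((\<lambda>m. act m g) ` translates \<Gamma> \<psi>)"
    by (rule a.generate_img[OF translates_subset, symmetric])
  also have "\<dots> \<subseteq> generate M (translates \<Gamma> \<psi>)"
    using translates_act g by (intro M.mono_generate) blast
  finally show "act m g \<in> generate M (translates \<Gamma> \<psi>)" using m by blast
qed

text \<open>Conjugation by a translate \<open>y\<close> is the action of \<open>n y\<close>, so it permutes the translates, and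
  Dietzmann's lemma applies.\<close>

lemma finite_generated_part:
  assumes "finite (carrier \<Gamma>)" "finite (carrier G)"
  shows "finite (generate M (translates \<Gamma> \<psi>))"
proof (rule M.dietzmann(1)[where m = "order \<Gamma>"])
  have "translates \<Gamma> \<psi> = (\<lambda>(\<gamma>, g). act (\<psi> \<gamma>) g) ` (carrier \<Gamma> \<times> carrier G)"
    unfolding translates_def by auto
  then show "finite (translates \<Gamma> \<psi>)" using assms by simp
  show "0 < order \<Gamma>" using assms(1) by (simp add: \<psi>.order_gt_0_iff_finite)
  fix x assume x: "x \<in> translates \<Gamma> \<psi>"
  then obtain \<gamma> g where g: "\<gamma> \<in> carrier \<Gamma>" "g \<in> carrier G" "x = act (\<psi> \<gamma>) g"
    unfolding translates_def by blast
  interpret a: group_hom M M "\<lambda>m. act m g" by (rule act_hom[OF g(2)])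
  have "x [^]\<^bsub>M\<^esub> order \<Gamma> = act (\<psi> (\<gamma> [^]\<^bsub>\<Gamma>\<^esub> order \<Gamma>)) g"
    using g by (simp add: a.hom_nat_pow \<psi>.hom_nat_pow)
  then show "x [^]\<^bsub>M\<^esub> order \<Gamma> = \<one>\<^bsub>M\<^esub>" using g by (simp add: \<psi>.pow_order_eq_1)
  fix y assume "y \<in> translates \<Gamma> \<psi>"
  then have "y \<in> carrier M" "x \<in> carrier M" using x translates_subset by auto
  then show "inv\<^bsub>M\<^esub> y \<otimes>\<^bsub>M\<^esub> x \<otimes>\<^bsub>M\<^esub> y \<in> translates \<Gamma> \<psi>"
    using translates_act[OF x, of "n y"] by (simp add: peiffer)
qed (rule translates_subset)

end

end

section \<open>Normal closures\<close>

locale normal_closure =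
  fixes \<Gamma> :: "'a monoid" and G :: "'g monoid" and \<phi> :: "'a \<Rightarrow> 'g"
    and C :: "'u monoid" and c :: "'a \<Rightarrow> 'u" and nbar :: "'u \<Rightarrow> 'g" and act :: "'u \<Rightarrow> 'g \<Rightarrow> 'u"
  assumes is_closure: "is_normal_closure \<Gamma> G \<phi> C c nbar act"
    and \<Gamma>: "group \<Gamma>" "finite (carrier \<Gamma>)" and finG: "finite (carrier G)"
    and \<phi>: "\<phi> \<in> hom \<Gamma> G"
    and inf: "infinite (UNIV :: 'u set)"
begin

sublocale crossed_module C G nbar act
  using is_closure unfolding is_normal_closure_def by unfold_locales blast

sublocale \<Gamma>: group \<Gamma> by (rule \<Gamma>)

sublocale c: group_hom \<Gamma> C c
  using is_closure unfolding is_normal_closure_def by unfold_locales blast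

lemma nbar_c: "\<gamma> \<in> carrier \<Gamma> \<Longrightarrow> nbar (c \<gamma>) = \<phi> \<gamma>"
  using is_closure unfolding is_normal_closure_def by blast

lemma universal:
  fixes M :: "'u monoid"
  assumes "normal_map M G n a" "\<psi> \<in> hom \<Gamma> M" "\<And>\<gamma>. \<gamma> \<in> carrier \<Gamma> \<Longrightarrow> n (\<psi> \<gamma>) = \<phi> \<gamma>"
  shows "\<exists>!u. u \<in> extensional (carrier C) \<and> normal_morphism G C nbar act M n a u \<and>
              (\<forall>\<gamma>\<in>carrier \<Gamma>. u (c \<gamma>) = \<psi> \<gamma>)"
  using is_closure assms unfolding is_normal_closure_def by blast

text \<open>The universal property maps \<open>C\<close> to the generated part. Followed by the inclusion, this is an
  endomorphism of \<open>C\<close> over \<open>G\<close> that fixes the elements \<open>c \<gamma>\<close>, hence the identity by uniqueness.\<close>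

lemma generated: "generate C (translates \<Gamma> c) = carrier C"
proof -
  let ?S = "generate C (translates \<Gamma> c)"
  have c: "group_hom \<Gamma> C c" by (rule c.group_hom_axioms)
  have sub: "?S \<subseteq> carrier C" by (rule M.generate_incl[OF translates_subset[OF c]])
  have "c \<in> hom \<Gamma> (C\<lparr>carrier := ?S\<rparr>)"
    using generate.incl[OF lift_in_translates[OF c]] by (intro homI) auto
  then obtain u where u: "u \<in> extensional (carrier C)"
      "normal_morphism G C nbar act (C\<lparr>carrier := ?S\<rparr>) nbar act u" "\<forall>\<gamma>\<in>carrier \<Gamma>. u (c \<gamma>) = c \<gamma>"
    using universal[OF generated_part_normal_map[OF c]] nbar_c by blast
  then have "normal_morphism G C nbar act C nbar act u"
    using sub unfolding normal_morphism_def hom_def by auto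
  moreover have "normal_morphism G C nbar act C nbar act (\<lambda>x\<in>carrier C. x)"
    unfolding normal_morphism_def by (auto intro!: homI)
  moreover have "c \<in> hom \<Gamma> C" by (rule c.homh)
  ultimately have "u = (\<lambda>x\<in>carrier C. x)"
    using universal[OF normal_map, of c] u(1,3) nbar_c c.hom_closed
    by (metis (no_types, lifting) restrict_apply' restrict_extensional)
  moreover have "u \<in> hom C (C\<lparr>carrier := ?S\<rparr>)"
    using u(2) unfolding normal_morphism_def by blast
  ultimately have "x \<in> ?S" if "x \<in> carrier C" for x
    using hom_in_carrier[of u C "C\<lparr>carrier := ?S\<rparr>" x] that by simp
  then show ?thesis using sub by blast
qed

lemma finite_closure: "finite (carrier C)"
  using finite_generated_part[OF c.group_hom_axioms \<Gamma>(2) finG] generated by simp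

text \<open>The universal property for normal maps on arbitrary types, and relative to a base change \<open>h\<close>:
  the test object is replaced by the finite part of its pullback generated by the lift, which has a
  copy on the infinite type of \<open>C\<close>.\<close>

lemma lift_exists:
  fixes M :: "'m monoid" and B :: "'b monoid"
  assumes "normal_map M B n a" "group_hom G B h" "\<psi> \<in> hom \<Gamma> M"
    and lift: "\<And>\<gamma>. \<gamma> \<in> carrier \<Gamma> \<Longrightarrow> n (\<psi> \<gamma>) = h (\<phi> \<gamma>)"
  obtains u where "u \<in> hom C M" "\<And>\<gamma>. \<gamma> \<in> carrier \<Gamma> \<Longrightarrow> u (c \<gamma>) = \<psi> \<gamma>"
    "\<And>x. x \<in> carrier C \<Longrightarrow> n (u x) = h (nbar x)"
proof -
  interpret MB: crossed_module M B n a by (unfold_locales) (rule assms(1))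
  define P where "P = (G \<times>\<times> M)\<lparr>carrier := {(b, m). b \<in> carrier G \<and> m \<in> carrier M \<and> h b = n m}\<rparr>"
  define aP where "aP = (\<lambda>(b, m) g. (inv\<^bsub>G\<^esub> g \<otimes>\<^bsub>G\<^esub> b \<otimes>\<^bsub>G\<^esub> g, a m (h g)))"
  interpret P: crossed_module P G fst aP
    unfolding P_def aP_def by unfold_locales (rule MB.pullback[OF assms(2)])
  let ?\<psi> = "\<lambda>\<gamma>. (\<phi> \<gamma>, \<psi> \<gamma>)"
  have "?\<psi> \<in> hom \<Gamma> P"
    using hom_in_carrier[OF \<phi>] hom_in_carrier[OF assms(3)] lift
      hom_mult[OF \<phi>] hom_mult[OF assms(3)]
    unfolding P_def by (intro homI) simp_all
  then have \<psi>P: "group_hom \<Gamma> P ?\<psi>" by unfold_locales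
  define S where "S = generate P (P.translates \<Gamma> ?\<psi>)"
  define Q where "Q = P\<lparr>carrier := S\<rparr>"
  interpret Q: crossed_module Q G fst aP
    unfolding Q_def S_def by unfold_locales (rule P.generated_part_normal_map[OF \<psi>P])
  have \<psi>Q: "?\<psi> \<in> hom \<Gamma> Q"
    using group_hom.homh[OF \<psi>P] generate.incl[OF P.lift_in_translates[OF \<psi>P]]
    unfolding Q_def S_def hom_def by auto
  have SP: "carrier Q \<subseteq> carrier P"
    unfolding Q_def S_def using P.M.generate_incl[OF P.translates_subset[OF \<psi>P]] by simp
  have "finite (carrier Q)" unfolding Q_def S_def using P.finite_generated_part[OF \<psi>P \<Gamma>(2) finG] by simp
  moreover obtain T :: "'u set" where "finite T" "card T = card (carrier Q)"
    using infinite_arbitrarily_large[OF inf] by blast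
  ultimately obtain j :: "'g \<times> 'm \<Rightarrow> 'u" where j: "inj_on j (carrier Q)"
    by (metis bij_betw_def finite_same_card_bij)
  let ?k = "inv_into (carrier Q) j"
  have "j \<circ> ?\<psi> \<in> hom \<Gamma> (image_group j Q)" by (rule hom_compose[OF \<psi>Q Q.transport(2)[OF j]])
  moreover have kj: "?k (j (?\<psi> \<gamma>)) = ?\<psi> \<gamma>" if "\<gamma> \<in> carrier \<Gamma>" for \<gamma>
    using j hom_in_carrier[OF \<psi>Q that] by simp
  ultimately obtain u where u: "normal_morphism G C nbar act (image_group j Q) (fst \<circ> ?k)
      (\<lambda>x g. j (aP (?k x) g)) u" "\<forall>\<gamma>\<in>carrier \<Gamma>. u (c \<gamma>) = j (?\<psi> \<gamma>)"
    using universal[OF Q.transport(1)[OF j], of "j \<circ> ?\<psi>"] by auto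
  have ku: "?k \<circ> u \<in> hom C Q"
    using u(1) hom_compose[OF _ Q.transport(3)[OF j]] unfolding normal_morphism_def by blast
  have "snd \<in> hom Q M" using SP unfolding Q_def P_def hom_def by auto
  then have "snd \<circ> (?k \<circ> u) \<in> hom C M" using hom_compose[OF ku] by blast
  moreover have "(snd \<circ> (?k \<circ> u)) (c \<gamma>) = \<psi> \<gamma>" if "\<gamma> \<in> carrier \<Gamma>" for \<gamma>
    using u(2) kj that by simp
  moreover have "n ((snd \<circ> (?k \<circ> u)) x) = h (nbar x)" if "x \<in> carrier C" for x
  proof -
    have "(?k \<circ> u) x \<in> carrier P" using hom_in_carrier[OF ku that] SP by blast
    then have "n (snd (?k (u x))) = h (fst (?k (u x)))" unfolding P_def by auto
    moreover have "fst (?k (u x)) = nbar x" using u(1) that unfolding normal_morphism_def by simp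
    ultimately show ?thesis by simp
  qed
  ultimately show thesis by (rule that)
qed

end

section \<open>Stable images in a tower\<close>

text \<open>The part of the tower of normal closures from \<open>\<Gamma>\<^sub>2\<close> on, with \<open>D i\<close> for \<open>\<Gamma>\<^sub>i\<^sub>+\<^sub>2\<close>. Of the universal
  property only generation by the translates is retained.\<close>

locale lifted_tower =
  fixes \<Gamma> :: "'a monoid" and D :: "nat \<Rightarrow> 'u monoid" and g :: "nat \<Rightarrow> 'a \<Rightarrow> 'u"
    and r :: "nat \<Rightarrow> 'u \<Rightarrow> 'u" and act :: "nat \<Rightarrow> 'u \<Rightarrow> 'u \<Rightarrow> 'u"
  assumes crossed: "\<And>i. crossed_module (D (Suc i)) (D i) (r i) (act i)"
    and fin: "\<And>i. finite (carrier (D i))" "finite (carrier \<Gamma>)"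
    and g: "\<And>i. group_hom \<Gamma> (D i) (g i)"
    and r_g: "\<And>i \<gamma>. \<gamma> \<in> carrier \<Gamma> \<Longrightarrow> r i (g (Suc i) \<gamma>) = g i \<gamma>"
    and generated: "\<And>i. generate (D (Suc i)) (crossed_module.translates (D i) (act i) \<Gamma> (g (Suc i)))
      = carrier (D (Suc i))"
begin

lemma group_D: "group (D i)"
  using g[of i] by (simp add: group_hom_def)

lemma r_hom: "group_hom (D (Suc i)) (D i) (r i)"
proof -
  interpret crossed_module "D (Suc i)" "D i" "r i" "act i" by (rule crossed)
  show ?thesis by (rule n.group_hom_axioms)
qed

text \<open>The composite \<open>D (i + d) \<rightarrow> D i\<close>.\<close>

primrec proj :: "nat \<Rightarrow> nat \<Rightarrow> 'u \<Rightarrow> 'u" where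
  "proj i 0 = (\<lambda>x. x)"
| "proj i (Suc d) = proj i d \<circ> r (i + d)"

lemma proj_hom: "group_hom (D (i + d)) (D i) (proj i d)"
proof (induction d)
  case 0
  show ?case using group_D by (simp add: group_hom_def group_hom_axioms_def hom_def)
next
  case (Suc d)
  then have "proj i d \<circ> r (i + d) \<in> hom (D (Suc (i + d))) (D i)"
    using r_hom[of "i + d"] by (intro hom_compose) (auto simp: group_hom_def group_hom_axioms_def)
  then show ?case by (simp add: group_hom_def group_hom_axioms_def group_D o_def)
qed

lemma proj_Suc_left: "proj i (Suc d) = r i \<circ> proj (Suc i) d"
proof (induction d)
  case (Suc d)
  have "proj i (Suc (Suc d)) = proj i (Suc d) \<circ> r (i + Suc d)" by (rule proj.simps)
  also have "\<dots> = r i \<circ> (proj (Suc i) d \<circ> r (Suc i + d))"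
    unfolding Suc by (simp add: comp_assoc)
  also have "\<dots> = r i \<circ> proj (Suc i) (Suc d)" by (simp only: proj.simps)
  finally show ?case .
qed (simp add: o_def)

lemma proj_g: "\<gamma> \<in> carrier \<Gamma> \<Longrightarrow> proj i d (g (i + d) \<gamma>) = g i \<gamma>"
  by (induction d) (simp_all add: r_g)

lemma proj_thread:
  assumes "\<And>i. r i (x (Suc i)) = x i"
  shows "proj i d (x (i + d)) = x i"
  by (induction d) (simp_all add: assms)

definition tower_image :: "nat \<Rightarrow> nat \<Rightarrow> 'u set" where
  "tower_image i d = proj i d ` carrier (D (i + d))"

definition stable_image :: "nat \<Rightarrow> 'u set" where
  "stable_image i = (\<Inter>d. tower_image i d)"

abbreviation L :: "nat \<Rightarrow> 'u monoid" where
  "L i \<equiv> D i\<lparr>carrier := stable_image i\<rparr>"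

lemma tower_image_0 [simp]: "tower_image i 0 = carrier (D i)"
  by (simp add: tower_image_def)

lemma tower_image_Suc: "tower_image i (Suc d) = r i ` tower_image (Suc i) d"
  unfolding tower_image_def proj_Suc_left by (simp add: image_comp)

lemma subgroup_tower_image: "subgroup (tower_image i d) (D i)"
  unfolding tower_image_def by (rule group_hom.img_is_subgroup[OF proj_hom])

lemma tower_image_antimono: "d \<le> e \<Longrightarrow> tower_image i e \<subseteq> tower_image i d"
proof (induction rule: dec_induct)
  case (step e)
  have "tower_image i (Suc e) \<subseteq> tower_image i e"
    unfolding tower_image_def using group_hom.hom_closed[OF r_hom] by auto
  then show ?case using step by blast
qed simp

lemma stable_image_reached: "\<exists>d0. \<forall>d\<ge>d0. tower_image i d = stable_image i"
proof -
  obtain d0 where d0: "\<And>d. card (tower_image i d0) \<le> card (tower_image i d)"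
    using ex_has_least_nat[of "\<lambda>_. True" 0 "\<lambda>d. card (tower_image i d)"] by auto
  have f: "finite (tower_image i d0)" unfolding tower_image_def using fin by simp
  have eq: "tower_image i d = tower_image i d0" if "d0 \<le> d" for d
    using card_subset_eq[OF f tower_image_antimono[OF that]] d0[of d] card_mono[OF f tower_image_antimono[OF that]]
    by simp
  have "tower_image i d0 \<subseteq> tower_image i d" for d
    using eq[of "max d d0"] tower_image_antimono[of d "max d d0" i] by simp
  then have "stable_image i = tower_image i d0" unfolding stable_image_def by blast
  then show ?thesis using eq by blast
qed

lemma subgroup_stable_image: "subgroup (stable_image i) (D i)"
  using stable_image_reached subgroup_tower_image by (metis order_refl)

lemma r_stable_image: "r i ` stable_image (Suc i) = stable_image i"
proof -
  obtain d0 d1 where "\<And>d. d0 \<le> d \<Longrightarrow> tower_image (Suc i) d = stable_image (Suc i)"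
    "\<And>d. d1 \<le> d \<Longrightarrow> tower_image i d = stable_image i"
    using stable_image_reached by meson
  then have "tower_image (Suc i) (max d0 d1) = stable_image (Suc i)"
    "tower_image i (Suc (max d0 d1)) = stable_image i" by simp_all
  then show ?thesis using tower_image_Suc[of i "max d0 d1"] by simp
qed

lemma g_stable_image:
  assumes "\<gamma> \<in> carrier \<Gamma>"
  shows "g i \<gamma> \<in> stable_image i"
proof -
  have "g i \<gamma> \<in> tower_image i d" for d
    unfolding tower_image_def using proj_g[OF assms, of i d, symmetric] group_hom.hom_closed[OF g assms]
    by (rule image_eqI)
  then show ?thesis unfolding stable_image_def by blast
qed

text \<open>The generators \<open>g \<gamma>\<^sup>y\<close> of \<open>D (i + d + 1)\<close> go to the conjugates of \<open>g \<gamma>\<close> by the images of the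
  \<open>y\<close>.\<close>

lemma tower_image_Suc_generated:
  "tower_image i (Suc d) = generate (D i)
     {inv\<^bsub>D i\<^esub> x \<otimes>\<^bsub>D i\<^esub> g i \<gamma> \<otimes>\<^bsub>D i\<^esub> x | \<gamma> x. \<gamma> \<in> carrier \<Gamma> \<and> x \<in> tower_image i d}"
proof -
  let ?j = "i + d"
  interpret c: crossed_module "D (Suc ?j)" "D ?j" "r ?j" "act ?j" by (rule crossed)
  interpret q: group_hom "D ?j" "D i" "proj i d" by (rule proj_hom)
  interpret q': group_hom "D (i + Suc d)" "D i" "proj i (Suc d)" by (rule proj_hom)
  have gh: "group_hom \<Gamma> (D (Suc ?j)) (g (Suc ?j))" by (rule g)
  have "tower_image i (Suc d) = proj i (Suc d) ` generate (D (i + Suc d)) (c.translates \<Gamma> (g (Suc ?j)))"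
    unfolding tower_image_def using generated[of ?j] by simp
  also have "\<dots> = generate (D i) (proj i (Suc d) ` c.translates \<Gamma> (g (Suc ?j)))"
    using c.translates_subset[OF gh] by (intro q'.generate_img[symmetric]) simp
  also have "proj i (Suc d) ` c.translates \<Gamma> (g (Suc ?j)) =
      (\<lambda>(\<gamma>, y). proj i d (r ?j (act ?j (g (Suc ?j) \<gamma>) y))) ` (carrier \<Gamma> \<times> carrier (D ?j))"
    unfolding c.translates_def by force
  also have "\<dots> = (\<lambda>(\<gamma>, y). inv\<^bsub>D i\<^esub> proj i d y \<otimes>\<^bsub>D i\<^esub> g i \<gamma> \<otimes>\<^bsub>D i\<^esub> proj i d y) `
      (carrier \<Gamma> \<times> carrier (D ?j))"
    using group_hom.hom_closed[OF gh] group_hom.hom_closed[OF g]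
    by (intro image_cong) (auto simp: c.equivariant r_g proj_g)
  also have "\<dots> = {inv\<^bsub>D i\<^esub> x \<otimes>\<^bsub>D i\<^esub> g i \<gamma> \<otimes>\<^bsub>D i\<^esub> x | \<gamma> x. \<gamma> \<in> carrier \<Gamma> \<and> x \<in> tower_image i d}"
    unfolding tower_image_def by force
  finally show ?thesis .
qed

lemma tower_image_Suc_normal: "tower_image i (Suc d) \<lhd> D i\<lparr>carrier := tower_image i d\<rparr>"
proof -
  interpret D: group "D i" by (rule group_D)
  interpret I: subgroup "tower_image i d" "D i" by (rule subgroup_tower_image)
  let ?I = "D i\<lparr>carrier := tower_image i d\<rparr>"
  let ?Y = "{inv\<^bsub>D i\<^esub> x \<otimes>\<^bsub>D i\<^esub> g i \<gamma> \<otimes>\<^bsub>D i\<^esub> x | \<gamma> x. \<gamma> \<in> carrier \<Gamma> \<and> x \<in> tower_image i d}"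
  interpret I': group ?I by (rule D.subgroup_imp_group[OF subgroup_tower_image])
  have gI: "g i \<gamma> \<in> tower_image i d" if "\<gamma> \<in> carrier \<Gamma>" for \<gamma>
    using g_stable_image[OF that] unfolding stable_image_def by blast
  have YI: "?Y \<subseteq> tower_image i d" using gI by auto
  have "generate ?I ?Y \<lhd> ?I"
  proof (rule I'.normal_generateI)
    show "?Y \<subseteq> carrier ?I" using YI by simp
    fix h y assume h: "h \<in> ?Y" and y: "y \<in> carrier ?I"
    then obtain \<gamma> x where x: "\<gamma> \<in> carrier \<Gamma>" "x \<in> tower_image i d"
      "h = inv\<^bsub>D i\<^esub> x \<otimes>\<^bsub>D i\<^esub> g i \<gamma> \<otimes>\<^bsub>D i\<^esub> x" by blast
    have "y \<otimes>\<^bsub>?I\<^esub> h \<otimes>\<^bsub>?I\<^esub> inv\<^bsub>?I\<^esub> y = inv\<^bsub>D i\<^esub> (x \<otimes>\<^bsub>D i\<^esub> inv\<^bsub>D i\<^esub> y) \<otimes>\<^bsub>D i\<^esub> g i \<gamma> \<otimes>\<^bsub>D i\<^esub> (x \<otimes>\<^bsub>D i\<^esub> inv\<^bsub>D i\<^esub> y)"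
      using x y gI by (simp add: D.m_inv_consistent[OF subgroup_tower_image] D.free_group_simps)
    moreover have "x \<otimes>\<^bsub>D i\<^esub> inv\<^bsub>D i\<^esub> y \<in> tower_image i d" using x y by simp
    ultimately show "y \<otimes>\<^bsub>?I\<^esub> h \<otimes>\<^bsub>?I\<^esub> inv\<^bsub>?I\<^esub> y \<in> ?Y" using x(1) by blast
  qed
  then show ?thesis
    unfolding tower_image_Suc_generated using D.generate_consistent[OF YI subgroup_tower_image] by simp
qed

lemma g_normally_generates_stable_image: "normally_generates (g i ` carrier \<Gamma>) (L i)"
  unfolding normally_generates_def
proof (intro allI impI)
  fix N assume N: "N \<lhd> L i" "g i ` carrier \<Gamma> \<subseteq> N"
  interpret D: group "D i" by (rule group_D)
  interpret S: subgroup "stable_image i" "D i" by (rule subgroup_stable_image)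
  interpret N: normal N "L i" by (rule N(1))
  obtain d where d: "tower_image i d = stable_image i" "tower_image i (Suc d) = stable_image i"
    using stable_image_reached by (metis le_SucI order_refl)
  have "inv\<^bsub>D i\<^esub> x \<otimes>\<^bsub>D i\<^esub> g i \<gamma> \<otimes>\<^bsub>D i\<^esub> x \<in> N" if "\<gamma> \<in> carrier \<Gamma>" "x \<in> stable_image i" for \<gamma> x
    using N.inv_op_closed1[of x "g i \<gamma>"] that N(2)
    by (auto simp: D.m_inv_consistent[OF subgroup_stable_image])
  moreover have "subgroup N (D i)"
    using D.incl_subgroup[OF subgroup_stable_image N.subgroup_axioms] .
  ultimately have "generate (D i)
      {inv\<^bsub>D i\<^esub> x \<otimes>\<^bsub>D i\<^esub> g i \<gamma> \<otimes>\<^bsub>D i\<^esub> x | \<gamma> x. \<gamma> \<in> carrier \<Gamma> \<and> x \<in> stable_image i} \<subseteq> N"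
    by (intro D.generate_subgroup_incl) auto
  then have "stable_image i \<subseteq> N" using tower_image_Suc_generated[of i d] unfolding d by simp
  then show "N = carrier (L i)" using N.subset by auto
qed

text \<open>The stable images form a tower of central extensions, because kernels of normal maps are
  central.\<close>

lemma stable_image_tower_stabilises:
  obtains i0 where "\<And>i. i \<ge> i0 \<Longrightarrow> inj_on (r i) (stable_image (Suc i))"
proof -
  have "\<exists>i0. \<forall>i\<ge>i0. inj_on (r i) (carrier (L (Suc i)))"
  proof (rule central_tower_stabilises[where H = "\<lambda>i. g i ` carrier \<Gamma>" and c = "card (carrier \<Gamma>)"])
    fix i
    interpret D: group "D i" by (rule group_D)
    interpret D': group "D (Suc i)" by (rule group_D)
    interpret c: crossed_module "D (Suc i)" "D i" "r i" "act i" by (rule crossed)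
    interpret L: group "L i" by (rule D.subgroup_imp_group[OF subgroup_stable_image])
    interpret L': group "L (Suc i)" by (rule D'.subgroup_imp_group[OF subgroup_stable_image])
    interpret S: subgroup "stable_image i" "D i" by (rule subgroup_stable_image)
    interpret S': subgroup "stable_image (Suc i)" "D (Suc i)" by (rule subgroup_stable_image)
    have "r i \<in> hom (L (Suc i)) (L i)" using r_stable_image[of i] by (intro homI) auto
    then show "group_hom (L (Suc i)) (L i) (r i)" by unfold_locales
    show "finite (carrier (L i))" using fin S.subset finite_subset by auto
    show "r i ` carrier (L (Suc i)) = carrier (L i)" using r_stable_image by simp
    show "z \<otimes>\<^bsub>L (Suc i)\<^esub> x = x \<otimes>\<^bsub>L (Suc i)\<^esub> z"
      if "z \<in> carrier (L (Suc i))" "r i z = \<one>\<^bsub>L i\<^esub>" "x \<in> carrier (L (Suc i))" for z x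
      using that c.kernel_central by simp
    have "g i \<in> hom \<Gamma> (L i)"
      using g_stable_image group_hom.hom_mult[OF g] by (intro homI) auto
    then interpret gi: group_hom \<Gamma> "L i" "g i"
      using g by (simp add: group_hom_def group_hom_axioms_def L.is_group)
    show "subgroup (g i ` carrier \<Gamma>) (L i)" by (rule gi.img_is_subgroup)
    show "normally_generates (g i ` carrier \<Gamma>) (L i)" by (rule g_normally_generates_stable_image)
    show "card (g i ` carrier \<Gamma>) \<le> card (carrier \<Gamma>)" using fin by (intro card_image_le)
  qed
  then show thesis using that by auto
qed

text \<open>A series for \<open>D i\<close> is prolonged by the inclusions of the images, each normal in the previous one,
  until the stable image is reached.\<close>

lemma subnormal_series_stable_image:
  assumes "subnormal_series G (D i) n"
  shows "subnormal_series G (L i) n"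
proof -
  have "subnormal_series G (D i\<lparr>carrier := tower_image i d\<rparr>) n" for d
  proof (induction d)
    case 0
    show ?case using assms by simp
  next
    case (Suc d)
    have "subnormal_series G (D i\<lparr>carrier := tower_image i d, carrier := tower_image i (Suc d)\<rparr>) (n \<circ> (\<lambda>x. x))"
      by (rule subnormal_series.step[OF Suc inclusion_normal_map[OF tower_image_Suc_normal]])
    then show ?case by (simp add: o_def)
  qed
  moreover obtain d where "tower_image i d = stable_image i" using stable_image_reached by blast
  ultimately show ?thesis by metis
qed

subsection \<open>Threads\<close>

definition threads :: "(nat \<Rightarrow> 'u) set" where
  "threads = {x. \<forall>i. x i \<in> carrier (D i) \<and> r i (x (Suc i)) = x i}"

lemma thread_stable:
  assumes "x \<in> threads"
  shows "x i \<in> stable_image i"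
proof -
  have "x i \<in> tower_image i d" for d
    unfolding tower_image_def
  proof (rule image_eqI)
    show "x i = proj i d (x (i + d))" "x (i + d) \<in> carrier (D (i + d))"
      using assms proj_thread[of x i d] unfolding threads_def by simp_all
  qed
  then show ?thesis unfolding stable_image_def by blast
qed

text \<open>Components below \<open>i\<close> are determined by projection, those above by injectivity.\<close>

lemma thread_eqI:
  assumes inj: "\<And>j. j \<ge> i \<Longrightarrow> inj_on (r j) (stable_image (Suc j))"
    and "x \<in> threads" "y \<in> threads" "x i = y i"
  shows "x = y"
proof
  fix j
  have up: "x (i + d) = y (i + d)" for d
  proof (induction d)
    case (Suc d)
    have "r (i + d) (x (Suc (i + d))) = r (i + d) (y (Suc (i + d)))"
      using Suc assms(2,3) unfolding threads_def by simp
    then show ?case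
      using inj_onD[OF inj[of "i + d"]] assms(2,3) thread_stable by simp
  qed (simp add: assms)
  show "x j = y j"
  proof (cases "i \<le> j")
    case True
    then show ?thesis using up[of "j - i"] by simp
  next
    case False
    then show ?thesis
      using proj_thread[of x j "i - j"] proj_thread[of y j "i - j"] assms(2-4) unfolding threads_def
      by simp
  qed
qed

text \<open>Above \<open>i\<close> the thread is chosen step by step, using that the stable images map onto each other.\<close>

lemma thread_through:
  assumes "y \<in> stable_image i"
  obtains x where "x \<in> threads" "x i = y"
proof -
  have "\<exists>z. z 0 = y \<and> (\<forall>d. z d \<in> stable_image (i + d) \<and> r (i + d) (z (Suc d)) = z d)"
  proof -
    have "\<exists>z. \<forall>d. (z d \<in> stable_image (i + d) \<and> (d = 0 \<longrightarrow> z d = y)) \<and> r (i + d) (z (Suc d)) = z d"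
    proof (rule dependent_nat_choice)
      show "\<exists>x. x \<in> stable_image (i + 0) \<and> (0 = 0 \<longrightarrow> x = y)" using assms by auto
      show "\<exists>y'. (y' \<in> stable_image (i + Suc d) \<and> (Suc d = 0 \<longrightarrow> y' = y)) \<and> r (i + d) y' = x"
        if "x \<in> stable_image (i + d) \<and> (d = 0 \<longrightarrow> x = y)" for x d
      proof -
        have "x \<in> r (i + d) ` stable_image (Suc (i + d))" using that r_stable_image by simp
        then show ?thesis by auto
      qed
    qed
    then show ?thesis by blast
  qed
  then obtain z where z: "z 0 = y" "\<And>d. z d \<in> stable_image (i + d)" "\<And>d. r (i + d) (z (Suc d)) = z d"
    by blast
  define x where "x j = (if i \<le> j then z (j - i) else proj j (i - j) y)" for j
  have yD: "y \<in> carrier (D i)" using assms subgroup.subset[OF subgroup_stable_image] by blast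
  have "x j \<in> carrier (D j)" for j
    using z(2)[of "j - i"] subgroup.subset[OF subgroup_stable_image[of j]]
      group_hom.hom_closed[OF proj_hom[of j "i - j"]] yD
    unfolding x_def by auto
  moreover have "r j (x (Suc j)) = x j" for j
  proof (cases "i \<le> j")
    case True
    then show ?thesis using z(3)[of "j - i"] unfolding x_def by (simp add: Suc_diff_le)
  next
    case False
    then have "i - j = Suc (i - Suc j)" by simp
    then have "x j = r j (proj (Suc j) (i - Suc j) y)"
      using False proj_Suc_left[of j "i - Suc j"] unfolding x_def by simp
    moreover have "x (Suc j) = proj (Suc j) (i - Suc j) y"
      using False z(1) unfolding x_def by (cases "i = Suc j") auto
    ultimately show ?thesis by simp
  qed
  ultimately have "x \<in> threads" unfolding threads_def by blast
  moreover have "x i = y" unfolding x_def using z(1) by simp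
  ultimately show thesis by (rule that)
qed

end

section \<open>Lifting through subnormal maps\<close>

text \<open>The lifts differ by elements of the central kernel, so the elements on which they agree form a
  normal subgroup.\<close>

lemma (in crossed_module) lift_unique:
  assumes t: "group_hom L M t" "group_hom L M t'"
    and Y: "normally_generates Y L" "Y \<subseteq> carrier L" "\<And>y. y \<in> Y \<Longrightarrow> t y = t' y"
    and n: "\<And>x. x \<in> carrier L \<Longrightarrow> n (t x) = n (t' x)"
    and x: "x \<in> carrier L"
  shows "t x = t' x"
proof -
  interpret t: group_hom L M t by (rule t)
  interpret t': group_hom L M t' by (rule t)
  let ?E = "{x \<in> carrier L. t x = t' x}"
  have "?E \<lhd> L"
  proof (rule t.G.normalI_conjugate)
    show "subgroup ?E L" by (rule t.G.subgroupI) (use t.hom_one t'.hom_one in auto)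
    fix x g assume x: "x \<in> ?E" and g: "g \<in> carrier L"
    let ?z = "inv\<^bsub>M\<^esub> (t' g) \<otimes>\<^bsub>M\<^esub> t g"
    have z: "?z \<in> carrier M" "n ?z = \<one>\<^bsub>G\<^esub>" using g n[OF g] by simp_all
    have "t g = t' g \<otimes>\<^bsub>M\<^esub> ?z" using g by (simp add: M.mult_inv_cancel_left)
    then have "inv\<^bsub>M\<^esub> (t g) \<otimes>\<^bsub>M\<^esub> t x \<otimes>\<^bsub>M\<^esub> t g
        = inv\<^bsub>M\<^esub> ?z \<otimes>\<^bsub>M\<^esub> (inv\<^bsub>M\<^esub> (t' g) \<otimes>\<^bsub>M\<^esub> t x \<otimes>\<^bsub>M\<^esub> t' g) \<otimes>\<^bsub>M\<^esub> ?z"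
      using x g by (simp add: M.free_group_simps)
    also have "\<dots> = inv\<^bsub>M\<^esub> (t' g) \<otimes>\<^bsub>M\<^esub> t x \<otimes>\<^bsub>M\<^esub> t' g"
      using x g z kernel_central[OF z, of "inv\<^bsub>M\<^esub> (t' g) \<otimes>\<^bsub>M\<^esub> t x \<otimes>\<^bsub>M\<^esub> t' g"]
      by (intro M.conjugate_fixes_if_commute) simp_all
    finally show "inv\<^bsub>L\<^esub> g \<otimes>\<^bsub>L\<^esub> x \<otimes>\<^bsub>L\<^esub> g \<in> ?E" using x g by simp
  qed
  then have "?E = carrier L" using Y unfolding normally_generates_def by blast
  then show ?thesis using x by blast
qed

lemma subnormal_series_lift_unique:
  assumes "subnormal_series G M n" "group L" "t \<in> hom L M" "t' \<in> hom L M"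
    and Y: "normally_generates Y L" "Y \<subseteq> carrier L" "\<And>y. y \<in> Y \<Longrightarrow> t y = t' y"
    and "\<And>x. x \<in> carrier L \<Longrightarrow> n (t x) = n (t' x)" "x \<in> carrier L"
  shows "t x = t' x"
  using assms(1,3,4,7,8,9)
proof (induction arbitrary: t t' x rule: subnormal_series.induct)
  case (single M n act)
  interpret crossed_module M G n act by unfold_locales (rule single)
  have gh: "group_hom L M t" "group_hom L M t'"
    using single.prems assms(2) by (simp_all add: group_hom_def group_hom_axioms_def M.is_group)
  show ?case by (rule lift_unique[OF gh Y(1,2) single.prems(3-5)])
next
  case (step M n M' n' act)
  interpret crossed_module M' M n' act by unfold_locales (rule step)
  have eq: "n' (t x) = n' (t' x)" if "x \<in> carrier L" for x
  proof -
    have "n' \<circ> t \<in> hom L M" "n' \<circ> t' \<in> hom L M"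
      using step.prems(1,2) hom_compose n.homh by blast+
    from step.IH[OF this _ _ that] show ?thesis using step.prems by simp
  qed
  have gh: "group_hom L M' t" "group_hom L M' t'"
    using step.prems assms(2) by (simp_all add: group_hom_def group_hom_axioms_def M.is_group)
  show ?case by (rule lift_unique[OF gh Y(1,2) step.prems(3) eq step.prems(5)])
qed

section \<open>The tower of normal closures and its limit\<close>

locale closure_tower =
  fixes \<Gamma> :: "'a monoid" and G :: "'g monoid" and \<phi> :: "'a \<Rightarrow> 'g"
    and T :: "nat \<Rightarrow> 'u monoid" and f :: "nat \<Rightarrow> 'a \<Rightarrow> 'u"
    and p1 :: "'u \<Rightarrow> 'g" and p :: "nat \<Rightarrow> 'u \<Rightarrow> 'u"
  assumes inf: "infinite (UNIV :: 'u set)"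
    and \<Gamma>: "group \<Gamma>" "finite (carrier \<Gamma>)"
    and G: "group G" "finite (carrier G)"
    and \<phi>: "\<phi> \<in> hom \<Gamma> G"
    and tower: "normal_closures_tower \<Gamma> G \<phi> T f p1 p"
begin

\<comment> \<open>stage \<open>i\<close> of the tower from \<open>\<Gamma>\<^sub>2\<close> on is always written \<open>T (i + 2)\<close>\<close>
declare add_2_eq_Suc' [simp del]

lemma first_closure: obtains a where "normal_closure \<Gamma> G \<phi> (T 2) (f 2) p1 a"
  using tower \<Gamma> G \<phi> inf unfolding normal_closures_tower_def normal_closure_def by blast

definition act :: "nat \<Rightarrow> 'u \<Rightarrow> 'u \<Rightarrow> 'u" where
  "act i = (SOME a. is_normal_closure \<Gamma> (T (i + 2)) (f (i + 2)) (T (Suc i + 2)) (f (Suc i + 2)) (p (i + 2)) a)"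

lemma is_normal_closure_act:
  "is_normal_closure \<Gamma> (T (i + 2)) (f (i + 2)) (T (Suc i + 2)) (f (Suc i + 2)) (p (i + 2)) (act i)"
proof -
  have "\<exists>a. is_normal_closure \<Gamma> (T (i + 2)) (f (i + 2)) (T (Suc (i + 2))) (f (Suc (i + 2))) (p (i + 2)) a"
    using tower unfolding normal_closures_tower_def by (metis le_add2)
  then show ?thesis unfolding act_def add_Suc by (rule someI_ex)
qed

lemma stage: "finite (carrier (T (i + 2))) \<and> f (i + 2) \<in> hom \<Gamma> (T (i + 2))"
proof (induction i)
  case 0
  obtain a where "normal_closure \<Gamma> G \<phi> (T 2) (f 2) p1 a" by (rule first_closure)
  then interpret normal_closure \<Gamma> G \<phi> "T 2" "f 2" p1 a .
  show ?case using finite_closure c.homh by simp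
next
  case (Suc i)
  interpret normal_closure \<Gamma> "T (i + 2)" "f (i + 2)" "T (Suc i + 2)" "f (Suc i + 2)" "p (i + 2)" "act i"
    using is_normal_closure_act \<Gamma> Suc inf by (intro normal_closure.intro) blast+
  show ?case using finite_closure c.homh by simp
qed

lemma closure: "normal_closure \<Gamma> (T (i + 2)) (f (i + 2)) (T (Suc i + 2)) (f (Suc i + 2)) (p (i + 2)) (act i)"
  using is_normal_closure_act \<Gamma> stage inf by (intro normal_closure.intro) blast+

sublocale lifted_tower \<Gamma> "\<lambda>i. T (i + 2)" "\<lambda>i. f (i + 2)" "\<lambda>i. p (i + 2)" act
proof (rule lifted_tower.intro, goal_cases)
  case (1 i)
  interpret normal_closure \<Gamma> "T (i + 2)" "f (i + 2)" "T (Suc i + 2)" "f (Suc i + 2)" "p (i + 2)" "act i"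
    by (rule closure)
  show ?case by (rule crossed_module_axioms)
next
  case (2 i)
  show ?case using stage by blast
next
  case 3
  show ?case by (rule \<Gamma>)
next
  case (4 i)
  interpret normal_closure \<Gamma> "T (i + 2)" "f (i + 2)" "T (Suc i + 2)" "f (Suc i + 2)" "p (i + 2)" "act i"
    by (rule closure)
  show ?case using \<Gamma> stage G.is_group by (simp add: group_hom_def group_hom_axioms_def)
next
  case (5 i \<gamma>)
  interpret normal_closure \<Gamma> "T (i + 2)" "f (i + 2)" "T (Suc i + 2)" "f (Suc i + 2)" "p (i + 2)" "act i"
    by (rule closure)
  show ?case using nbar_c 5 by blast
next
  case (6 i)
  interpret normal_closure \<Gamma> "T (i + 2)" "f (i + 2)" "T (Suc i + 2)" "f (Suc i + 2)" "p (i + 2)" "act i"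
    by (rule closure)
  show ?case by (rule generated)
qed

lemma group_T: "2 \<le> i \<Longrightarrow> group (T i)"
  using group_D[of "i - 2"] by simp

lemma p_hom: "2 \<le> i \<Longrightarrow> group_hom (T (Suc i)) (T i) (p i)"
  using r_hom[of "i - 2"] by (simp add: Suc_diff_le)

lemma p1_hom: "group_hom (T 2) G p1"
proof -
  obtain a where "normal_closure \<Gamma> G \<phi> (T 2) (f 2) p1 a" by (rule first_closure)
  then interpret normal_closure \<Gamma> G \<phi> "T 2" "f 2" p1 a .
  show ?thesis by (rule n.group_hom_axioms)
qed

lemma p1_f: "\<gamma> \<in> carrier \<Gamma> \<Longrightarrow> p1 (f 2 \<gamma>) = \<phi> \<gamma>"
proof -
  obtain a where "normal_closure \<Gamma> G \<phi> (T 2) (f 2) p1 a" by (rule first_closure)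
  then interpret normal_closure \<Gamma> G \<phi> "T 2" "f 2" p1 a .
  show "\<gamma> \<in> carrier \<Gamma> \<Longrightarrow> p1 (f 2 \<gamma>) = \<phi> \<gamma>" by (rule nbar_c)
qed

text \<open>The composite \<open>\<Gamma>\<^sub>i\<^sub>+\<^sub>2 \<rightarrow> G\<close>.\<close>

primrec bottom :: "nat \<Rightarrow> 'u \<Rightarrow> 'g" where
  "bottom 0 = p1"
| "bottom (Suc i) = bottom i \<circ> p (i + 2)"

lemma subnormal_series_bottom: "subnormal_series G (T (i + 2)) (bottom i)"
proof (induction i)
  case 0
  obtain a where "normal_closure \<Gamma> G \<phi> (T 2) (f 2) p1 a" by (rule first_closure)
  then interpret normal_closure \<Gamma> G \<phi> "T 2" "f 2" p1 a .
  show ?case using subnormal_series.single[OF normal_map] by simp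
next
  case (Suc i)
  interpret normal_closure \<Gamma> "T (i + 2)" "f (i + 2)" "T (Suc i + 2)" "f (Suc i + 2)" "p (i + 2)" "act i"
    by (rule closure)
  show ?case unfolding bottom.simps by (rule subnormal_series.step[OF Suc normal_map])
qed

text \<open>A lift of stage \<open>i\<close> to \<open>M\<close> extends to a lift of stage \<open>i + 1\<close> through a normal map \<open>M' \<rightarrow> M\<close>, by
  base change along the lift.\<close>

lemma subnormal_series_lift_exists:
  assumes "subnormal_series G M n" "\<psi> \<in> hom \<Gamma> M" "\<And>\<gamma>. \<gamma> \<in> carrier \<Gamma> \<Longrightarrow> n (\<psi> \<gamma>) = \<phi> \<gamma>"
  shows "\<exists>i u. u \<in> hom (T (i + 2)) M \<and> (\<forall>\<gamma>\<in>carrier \<Gamma>. u (f (i + 2) \<gamma>) = \<psi> \<gamma>) \<and>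
    (\<forall>x\<in>carrier (T (i + 2)). n (u x) = bottom i x)"
  using assms
proof (induction arbitrary: \<psi> rule: subnormal_series.induct)
  case (single M n a)
  obtain b where "normal_closure \<Gamma> G \<phi> (T 2) (f 2) p1 b" by (rule first_closure)
  then interpret normal_closure \<Gamma> G \<phi> "T 2" "f 2" p1 b .
  have "group_hom G G (\<lambda>x. x)" by unfold_locales (simp add: hom_def)
  from lift_exists[OF single(1) this single(2)] single(3)
  obtain u where "u \<in> hom (T 2) M" "\<And>\<gamma>. \<gamma> \<in> carrier \<Gamma> \<Longrightarrow> u (f 2 \<gamma>) = \<psi> \<gamma>"
    "\<And>x. x \<in> carrier (T 2) \<Longrightarrow> n (u x) = p1 x" by metis
  then show ?case by (intro exI[of _ 0] exI[of _ u]) simp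
next
  case (step M n M' n' a)
  have "n' \<circ> \<psi> \<in> hom \<Gamma> M"
    using step.hyps(2) step.prems(1) hom_compose unfolding normal_map_def by blast
  moreover have "n ((n' \<circ> \<psi>) \<gamma>) = \<phi> \<gamma>" if "\<gamma> \<in> carrier \<Gamma>" for \<gamma>
    using step.prems(2)[OF that] by simp
  ultimately obtain i u where u: "u \<in> hom (T (i + 2)) M"
      "\<forall>\<gamma>\<in>carrier \<Gamma>. u (f (i + 2) \<gamma>) = (n' \<circ> \<psi>) \<gamma>"
      "\<forall>x\<in>carrier (T (i + 2)). n (u x) = bottom i x"
    using step.IH by metis
  interpret normal_closure \<Gamma> "T (i + 2)" "f (i + 2)" "T (Suc i + 2)" "f (Suc i + 2)" "p (i + 2)" "act i"
    by (rule closure)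
  have "group_hom (T (i + 2)) M u"
    using u(1) step.hyps(2) G.is_group unfolding normal_map_def
    by (simp add: group_hom_def group_hom_axioms_def)
  from lift_exists[OF step.hyps(2) this step.prems(1)] u(2)
  obtain v where v: "v \<in> hom (T (Suc i + 2)) M'" "\<And>\<gamma>. \<gamma> \<in> carrier \<Gamma> \<Longrightarrow> v (f (Suc i + 2) \<gamma>) = \<psi> \<gamma>"
    "\<And>x. x \<in> carrier (T (Suc i + 2)) \<Longrightarrow> n' (v x) = u (p (i + 2) x)" by (metis o_apply)
  have "(n \<circ> n') (v x) = bottom (Suc i) x" if "x \<in> carrier (T (Suc i + 2))" for x
    using v(3)[OF that] u(3) n.hom_closed[OF that] by simp
  then show ?case using v by blast
qed

lemma subnormal_map_lift_exists:
  assumes "subnormal_map TYPE('v) S G s" "\<psi> \<in> hom \<Gamma> S" "\<And>\<gamma>. \<gamma> \<in> carrier \<Gamma> \<Longrightarrow> s (\<psi> \<gamma>) = \<phi> \<gamma>"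
  shows "\<exists>i u. u \<in> hom (T (i + 2)) S \<and> (\<forall>\<gamma>\<in>carrier \<Gamma>. u (f (i + 2) \<gamma>) = \<psi> \<gamma>) \<and>
    (\<forall>x\<in>carrier (T (i + 2)). s (u x) = bottom i x)"
proof -
  consider a where "normal_map S G s a"
    | M :: "'v monoid" and n n' a where "subnormal_series G M n" "normal_map S M n' a"
        "\<And>x. x \<in> carrier S \<Longrightarrow> s x = n (n' x)"
    using assms(1) unfolding subnormal_map_def by blast
  then show ?thesis
  proof cases
    case 1
    then show ?thesis
      using subnormal_series_lift_exists[OF subnormal_series.single assms(2,3)] by blast
  next
    case (2 M n n' a)
    have "n' \<circ> \<psi> \<in> hom \<Gamma> M"
      using 2(2) assms(2) hom_compose unfolding normal_map_def by blast
    moreover have "n ((n' \<circ> \<psi>) \<gamma>) = \<phi> \<gamma>" if "\<gamma> \<in> carrier \<Gamma>" for \<gamma>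
      using 2(3)[OF hom_in_carrier[OF assms(2) that]] assms(3)[OF that] by simp
    ultimately obtain i u where u: "u \<in> hom (T (i + 2)) M"
        "\<forall>\<gamma>\<in>carrier \<Gamma>. u (f (i + 2) \<gamma>) = (n' \<circ> \<psi>) \<gamma>"
        "\<forall>x\<in>carrier (T (i + 2)). n (u x) = bottom i x"
      using subnormal_series_lift_exists[OF 2(1)] by metis
    interpret normal_closure \<Gamma> "T (i + 2)" "f (i + 2)" "T (Suc i + 2)" "f (Suc i + 2)" "p (i + 2)" "act i"
      by (rule closure)
    have "group_hom (T (i + 2)) M u"
      using u(1) 2(2) G.is_group unfolding normal_map_def
      by (simp add: group_hom_def group_hom_axioms_def)
    from lift_exists[OF 2(2) this assms(2)] u(2)
    obtain v where v: "v \<in> hom (T (Suc i + 2)) S" "\<And>\<gamma>. \<gamma> \<in> carrier \<Gamma> \<Longrightarrow> v (f (Suc i + 2) \<gamma>) = \<psi> \<gamma>"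
      "\<And>x. x \<in> carrier (T (Suc i + 2)) \<Longrightarrow> n' (v x) = u (p (i + 2) x)" by (metis o_apply)
    have "s (v x) = bottom (Suc i) x" if "x \<in> carrier (T (Suc i + 2))" for x
      using v(3)[OF that] u(3) n.hom_closed[OF that] 2(3) hom_in_carrier[OF v(1) that] by simp
    then show ?thesis using v by blast
  qed
qed

subsection \<open>The limit\<close>

abbreviation limit :: "('g \<times> (nat \<Rightarrow> 'u)) monoid" where
  "limit \<equiv> tower_limit G T p1 p"

definition component :: "nat \<Rightarrow> 'g \<times> (nat \<Rightarrow> 'u) \<Rightarrow> 'u" where
  "component i z = snd z (i + 2)"

lemma mem_limit_iff:
  "z \<in> carrier limit \<longleftrightarrow>
    snd z \<in> extensional {2..} \<and> (\<lambda>i. component i z) \<in> threads \<and> fst z = p1 (component 0 z)"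
proof -
  have shift: "(\<forall>i\<ge>2. P i) \<longleftrightarrow> (\<forall>i. P (i + 2))" for P :: "nat \<Rightarrow> bool"
    by (metis le_add2 le_add_diff_inverse2)
  have p1: "p1 x \<in> carrier G" if "x \<in> carrier (T 2)" for x
    using group_hom.hom_closed[OF p1_hom that] .
  have "z \<in> carrier limit \<longleftrightarrow> fst z \<in> carrier G \<and> snd z \<in> extensional {2..} \<and>
      (\<forall>i\<ge>2. snd z i \<in> carrier (T i)) \<and> p1 (snd z 2) = fst z \<and> (\<forall>i\<ge>2. p i (snd z (Suc i)) = snd z i)"
    unfolding tower_limit_def by (auto simp: PiE_def Pi_def split: prod.splits)
  moreover have "fst z \<in> carrier G"
    if "\<forall>i. snd z (i + 2) \<in> carrier (T (i + 2))" "fst z = p1 (snd z 2)"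
    using p1 that(2) spec[OF that(1), of 0] by simp
  ultimately show ?thesis
    unfolding threads_def component_def shift by (auto simp: all_conj_distrib)
qed

lemma limit_component:
  assumes "z \<in> carrier limit"
  shows "component i z \<in> carrier (T (i + 2))" "p (i + 2) (component (Suc i) z) = component i z"
    "p1 (component 0 z) = fst z"
  using assms unfolding mem_limit_iff threads_def by (blast, blast, simp)

lemma mem_limitI:
  assumes "snd z \<in> extensional {2..}" "\<And>i. component i z \<in> carrier (T (i + 2))"
    "\<And>i. p (i + 2) (component (Suc i) z) = component i z" "p1 (component 0 z) = fst z"
  shows "z \<in> carrier limit"
  using assms unfolding mem_limit_iff threads_def by simp

lemma limit_eqI:
  assumes "z \<in> carrier limit" "z' \<in> carrier limit" "\<And>i. component i z = component i z'"
  shows "z = z'"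
proof (rule prod_eqI)
  show "fst z = fst z'" using assms by (simp add: mem_limit_iff)
  show "snd z = snd z'"
  proof (rule extensionalityI)
    show "snd z \<in> extensional {2..}" "snd z' \<in> extensional {2..}" using assms(1,2) by (simp_all add: mem_limit_iff)
    show "snd z i = snd z' i" if "i \<in> {2..}" for i
      using assms(3)[of "i - 2"] that unfolding component_def by simp
  qed
qed

lemma group_limit: "group limit"
proof -
  let ?P = "G \<times>\<times> product_group {2..} T"
  have P: "group (product_group {2..} T)" using group_T by (intro product_group) simp
  interpret P: group ?P by (rule DirProd_group[OF G(1) P])
  interpret G: group G by (rule G)
  have sub: "carrier limit \<subseteq> carrier ?P" unfolding tower_limit_def by auto
  have inv: "inv\<^bsub>?P\<^esub> z = (inv\<^bsub>G\<^esub> (fst z), \<lambda>i\<in>{2..}. inv\<^bsub>T i\<^esub> (snd z i))" if "z \<in> carrier ?P" for z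
    using that group_T by (cases z) (auto simp: inv_DirProd[OF G(1) P] intro!: inv_product_group)
  have p1: "group_hom (T (0 + 2)) G p1" using p1_hom by simp
  have "subgroup (carrier limit) ?P"
  proof (rule P.subgroupI[OF sub])
    have c: "component i \<one>\<^bsub>?P\<^esub> = \<one>\<^bsub>T (i + 2)\<^esub>" for i
      unfolding component_def by simp
    have "\<one>\<^bsub>?P\<^esub> \<in> carrier limit"
    proof (rule mem_limitI, unfold c)
      show "\<one>\<^bsub>T (i + 2)\<^esub> \<in> carrier (T (i + 2))" for i
        by (rule monoid.one_closed[OF group.is_monoid[OF group_D]])
      show "p (i + 2) \<one>\<^bsub>T (Suc i + 2)\<^esub> = \<one>\<^bsub>T (i + 2)\<^esub>" for i
        by (rule group_hom.hom_one[OF r_hom])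
      show "p1 \<one>\<^bsub>T (0 + 2)\<^esub> = fst \<one>\<^bsub>?P\<^esub>" using group_hom.hom_one[OF p1] by simp
    qed simp
    then show "carrier limit \<noteq> {}" by blast
  next
    fix z assume z: "z \<in> carrier limit"
    have c: "component i (inv\<^bsub>?P\<^esub> z) = inv\<^bsub>T (i + 2)\<^esub> (component i z)" for i
      unfolding inv[OF subsetD[OF sub z]] component_def by simp
    show "inv\<^bsub>?P\<^esub> z \<in> carrier limit"
    proof (rule mem_limitI, unfold c)
      show "snd (inv\<^bsub>?P\<^esub> z) \<in> extensional {2..}"
        unfolding inv[OF subsetD[OF sub z]] by simp
      show "inv\<^bsub>T (i + 2)\<^esub> (component i z) \<in> carrier (T (i + 2))" for i
        by (rule group.inv_closed[OF group_D limit_component(1)[OF z]])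
      show "p (i + 2) (inv\<^bsub>T (Suc i + 2)\<^esub> (component (Suc i) z)) = inv\<^bsub>T (i + 2)\<^esub> (component i z)" for i
        using group_hom.hom_inv[OF r_hom limit_component(1)[OF z]] limit_component(2)[OF z] by metis
      show "p1 (inv\<^bsub>T (0 + 2)\<^esub> (component 0 z)) = fst (inv\<^bsub>?P\<^esub> z)"
        unfolding inv[OF subsetD[OF sub z]] fst_conv group_hom.hom_inv[OF p1 limit_component(1)[OF z]]
          limit_component(3)[OF z] ..
    qed
  next
    fix z z' assume z: "z \<in> carrier limit" "z' \<in> carrier limit"
    have c: "component i (z \<otimes>\<^bsub>?P\<^esub> z') = component i z \<otimes>\<^bsub>T (i + 2)\<^esub> component i z'" for i
      unfolding component_def by (simp add: mult_DirProd')
    show "z \<otimes>\<^bsub>?P\<^esub> z' \<in> carrier limit"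
    proof (rule mem_limitI, unfold c)
      show "snd (z \<otimes>\<^bsub>?P\<^esub> z') \<in> extensional {2..}" by (simp add: mult_DirProd')
      show "component i z \<otimes>\<^bsub>T (i + 2)\<^esub> component i z' \<in> carrier (T (i + 2))" for i
        using z by (intro monoid.m_closed[OF group.is_monoid[OF group_D]] limit_component(1))
      show "p (i + 2) (component (Suc i) z \<otimes>\<^bsub>T (Suc i + 2)\<^esub> component (Suc i) z')
          = component i z \<otimes>\<^bsub>T (i + 2)\<^esub> component i z'" for i
        using group_hom.hom_mult[OF r_hom limit_component(1)[OF z(1)] limit_component(1)[OF z(2)]]
          limit_component(2)[OF z(1)] limit_component(2)[OF z(2)] by metis
      show "p1 (component 0 z \<otimes>\<^bsub>T (0 + 2)\<^esub> component 0 z') = fst (z \<otimes>\<^bsub>?P\<^esub> z')"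
        unfolding group_hom.hom_mult[OF p1 limit_component(1)[OF z(1)] limit_component(1)[OF z(2)]]
          limit_component(3)[OF z(1)] limit_component(3)[OF z(2)] by (simp add: mult_DirProd')
    qed
  qed
  moreover have "limit = ?P\<lparr>carrier := carrier limit\<rparr>" unfolding tower_limit_def by simp
  ultimately show ?thesis by (metis P.subgroup_imp_group)
qed

lemma mult_limit:
  "fst (z \<otimes>\<^bsub>limit\<^esub> z') = fst z \<otimes>\<^bsub>G\<^esub> fst z'"
  "component i (z \<otimes>\<^bsub>limit\<^esub> z') = component i z \<otimes>\<^bsub>T (i + 2)\<^esub> component i z'"
  unfolding tower_limit_def component_def by (simp_all add: mult_DirProd')

lemma component_stable: "z \<in> carrier limit \<Longrightarrow> component i z \<in> stable_image i"
  using thread_stable[of "\<lambda>i. component i z" i] by (simp add: mem_limit_iff)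

lemma component_hom: "component i \<in> hom limit (L i)"
  using component_stable by (intro homI) (auto simp: mult_limit)

lemma bottom_component: "z \<in> carrier limit \<Longrightarrow> bottom i (component i z) = tower_proj z"
proof (induction i)
  case 0
  then show ?case by (simp add: mem_limit_iff tower_proj_def)
next
  case (Suc i)
  then show ?case by (simp add: mem_limit_iff threads_def)
qed

text \<open>Any stage from which on the stable images are identified by the tower maps will do.\<close>

lemma component_iso: obtains i where "component i \<in> iso limit (L i)"
proof -
  obtain i where i: "\<And>j. j \<ge> i \<Longrightarrow> inj_on (p (j + 2)) (stable_image (Suc j))"
    using stable_image_tower_stabilises by blast
  have "inj_on (component i) (carrier limit)"
  proof (rule inj_onI)
    fix z z' assume z: "z \<in> carrier limit" "z' \<in> carrier limit" "component i z = component i z'"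
    have eq: "(\<lambda>j. component j z) = (\<lambda>j. component j z')"
      using z by (intro thread_eqI[of i, OF i]) (simp_all add: mem_limit_iff)
    show "z = z'" by (rule limit_eqI[OF z(1,2) fun_cong[OF eq]])
  qed
  moreover have "y \<in> component i ` carrier limit" if y: "y \<in> stable_image i" for y
  proof -
    obtain x where x: "x \<in> threads" "x i = y" by (rule thread_through[OF y])
    define z where "z = (p1 (x 0), \<lambda>j\<in>{2..}. x (j - 2))"
    have c: "component j z = x j" for j unfolding component_def z_def by simp
    have "z \<in> carrier limit" using x(1) unfolding mem_limit_iff c by (simp add: z_def)
    moreover have "y = component i z" using c x(2) by simp
    ultimately show ?thesis by (intro image_eqI)
  qed
  ultimately have "component i \<in> iso limit (L i)"
    using component_hom[of i] component_stable[of _ i] by (intro isoI) (auto simp: bij_betw_def)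
  then show thesis by (rule that)
qed

lemma component_tower_map: "component i (tower_map \<phi> f \<gamma>) = f (i + 2) \<gamma>"
  unfolding component_def tower_map_def by simp

lemma tower_map_hom: "tower_map \<phi> f \<in> hom \<Gamma> limit"
proof -
  interpret \<Gamma>: group \<Gamma> by (rule \<Gamma>)
  interpret limit: group limit by (rule group_limit)
  have closed: "tower_map \<phi> f \<gamma> \<in> carrier limit" if \<gamma>: "\<gamma> \<in> carrier \<Gamma>" for \<gamma>
  proof (rule mem_limitI, unfold component_tower_map)
    show "p (i + 2) (f (Suc i + 2) \<gamma>) = f (i + 2) \<gamma>" for i by (rule r_g[OF \<gamma>])
    show "f (i + 2) \<gamma> \<in> carrier (T (i + 2))" for i by (rule group_hom.hom_closed[OF g \<gamma>])
  qed (simp_all add: tower_map_def p1_f[OF \<gamma>])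
  show ?thesis
  proof (rule homI)
    fix \<gamma> \<delta> assume \<gamma>\<delta>: "\<gamma> \<in> carrier \<Gamma>" "\<delta> \<in> carrier \<Gamma>"
    show "tower_map \<phi> f (\<gamma> \<otimes>\<^bsub>\<Gamma>\<^esub> \<delta>) = tower_map \<phi> f \<gamma> \<otimes>\<^bsub>limit\<^esub> tower_map \<phi> f \<delta>"
    proof (rule limit_eqI)
      show "component i (tower_map \<phi> f (\<gamma> \<otimes>\<^bsub>\<Gamma>\<^esub> \<delta>))
          = component i (tower_map \<phi> f \<gamma> \<otimes>\<^bsub>limit\<^esub> tower_map \<phi> f \<delta>)" for i
        unfolding mult_limit component_tower_map by (rule group_hom.hom_mult[OF g \<gamma>\<delta>])
    qed (use \<gamma>\<delta> closed in simp_all)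
  qed (rule closed)
qed

lemma tower_map_normally_generates: "normally_generates (tower_map \<phi> f ` carrier \<Gamma>) limit"
proof -
  obtain i where i: "component i \<in> iso limit (L i)" by (rule component_iso)
  interpret limit: group limit by (rule group_limit)
  define k where "k = inv_into (carrier limit) (component i)"
  have k: "k \<in> iso (L i) limit" unfolding k_def by (rule limit.iso_set_sym[OF i])
  interpret L: group "L i" by (rule group.subgroup_imp_group[OF group_D subgroup_stable_image])
  interpret k: group_hom "L i" limit k using k by unfold_locales (simp add: iso_def)
  have "normally_generates (k ` (f (i + 2) ` carrier \<Gamma>)) limit"
    using k g_normally_generates_stable_image[of i] g_stable_image[of _ i]
    by (intro k.normally_generates_image) (auto simp: iso_def bij_betw_def)
  moreover have "k (f (i + 2) \<gamma>) = tower_map \<phi> f \<gamma>" if "\<gamma> \<in> carrier \<Gamma>" for \<gamma>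
    using i hom_in_carrier[OF tower_map_hom that] unfolding k_def component_tower_map[symmetric]
    by (simp add: iso_def bij_betw_def)
  ultimately show ?thesis by (simp add: image_image cong: image_cong)
qed

lemma tower_proj_hom: "tower_proj \<in> hom limit G"
proof -
  have "tower_proj z \<in> carrier G" if "z \<in> carrier limit" for z
    using that unfolding tower_limit_def tower_proj_def by auto
  then show ?thesis by (intro homI) (auto simp: tower_proj_def mult_limit)
qed

theorem subnormal_map_limit: "subnormal_map TYPE('u) limit G tower_proj"
proof -
  obtain i where i: "component i \<in> iso limit (L i)" by (rule component_iso)
  have "group (L i)" by (rule group.subgroup_imp_group[OF group_D subgroup_stable_image])
  then obtain a where a: "normal_map limit (L i) (component i) a"
    using iso_normal_map[OF group_limit _ i] by blast
  have "subnormal_series G (L i) (bottom i)"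
    by (rule subnormal_series_stable_image[OF subnormal_series_bottom])
  moreover have "\<forall>z\<in>carrier limit. tower_proj z = bottom i (component i z)"
    using bottom_component by simp
  ultimately show ?thesis unfolding subnormal_map_def using a tower_proj_hom by blast
qed

theorem limit_universal:
  assumes "group S" "subnormal_map TYPE('v) S G s" "\<psi> \<in> hom \<Gamma> S"
    and "\<And>\<gamma>. \<gamma> \<in> carrier \<Gamma> \<Longrightarrow> s (\<psi> \<gamma>) = \<phi> \<gamma>"
  shows "\<exists>!t. t \<in> extensional (carrier limit) \<and> t \<in> hom limit S \<and>
    (\<forall>\<gamma>\<in>carrier \<Gamma>. t (tower_map \<phi> f \<gamma>) = \<psi> \<gamma>) \<and> (\<forall>x\<in>carrier limit. s (t x) = tower_proj x)"
proof (rule ex_ex1I)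
  interpret limit: group limit by (rule group_limit)
  obtain i u where u: "u \<in> hom (T (i + 2)) S" "\<And>\<gamma>. \<gamma> \<in> carrier \<Gamma> \<Longrightarrow> u (f (i + 2) \<gamma>) = \<psi> \<gamma>"
      "\<And>x. x \<in> carrier (T (i + 2)) \<Longrightarrow> s (u x) = bottom i x"
    using subnormal_map_lift_exists[OF assms(2-4)] by metis
  have c: "component i z \<in> carrier (T (i + 2))" if "z \<in> carrier limit" for z
    using component_stable[OF that] subgroup.subset[OF subgroup_stable_image] by blast
  have "component i \<in> hom limit (T (i + 2))"
    using c by (intro homI) (auto simp: mult_limit)
  then have "u \<circ> component i \<in> hom limit S" using hom_compose u(1) by blast
  then have "restrict (u \<circ> component i) (carrier limit) \<in> hom limit S"
    by (rule limit.hom_restrict) simp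
  moreover have "restrict (u \<circ> component i) (carrier limit) (tower_map \<phi> f \<gamma>) = \<psi> \<gamma>"
    if "\<gamma> \<in> carrier \<Gamma>" for \<gamma>
    using u(2) that hom_in_carrier[OF tower_map_hom that]
    by (simp add: component_tower_map)
  moreover have "s (restrict (u \<circ> component i) (carrier limit) z) = tower_proj z"
    if "z \<in> carrier limit" for z
    using u(3)[OF c[OF that]] bottom_component[OF that] that by simp
  ultimately show "\<exists>t. t \<in> extensional (carrier limit) \<and> t \<in> hom limit S \<and>
    (\<forall>\<gamma>\<in>carrier \<Gamma>. t (tower_map \<phi> f \<gamma>) = \<psi> \<gamma>) \<and> (\<forall>x\<in>carrier limit. s (t x) = tower_proj x)"
    using restrict_extensional by metis
next
  interpret limit: group limit by (rule group_limit)
  fix t t'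
  assume t: "t \<in> extensional (carrier limit) \<and> t \<in> hom limit S \<and>
      (\<forall>\<gamma>\<in>carrier \<Gamma>. t (tower_map \<phi> f \<gamma>) = \<psi> \<gamma>) \<and> (\<forall>x\<in>carrier limit. s (t x) = tower_proj x)"
    and t': "t' \<in> extensional (carrier limit) \<and> t' \<in> hom limit S \<and>
      (\<forall>\<gamma>\<in>carrier \<Gamma>. t' (tower_map \<phi> f \<gamma>) = \<psi> \<gamma>) \<and> (\<forall>x\<in>carrier limit. s (t' x) = tower_proj x)"
  have Y: "tower_map \<phi> f ` carrier \<Gamma> \<subseteq> carrier limit" using hom_in_carrier[OF tower_map_hom] by blast
  have eqY: "t y = t' y" if "y \<in> tower_map \<phi> f ` carrier \<Gamma>" for y using that t t' by auto
  have hom: "t \<in> hom limit S" "t' \<in> hom limit S" using t t' by auto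
  have gh: "group_hom limit S t" "group_hom limit S t'"
    using hom assms(1) by (simp_all add: group_hom_def group_hom_axioms_def limit.is_group)
  note gen = tower_map_normally_generates
  consider a where "normal_map S G s a"
    | M :: "'v monoid" and n n' a where "subnormal_series G M n" "normal_map S M n' a"
        "\<And>x. x \<in> carrier S \<Longrightarrow> s x = n (n' x)"
    using assms(2) unfolding subnormal_map_def by blast
  then have "t x = t' x" if "x \<in> carrier limit" for x
  proof cases
    case (1 a)
    interpret crossed_module S G s a by unfold_locales (rule 1)
    show ?thesis using t t' by (intro lift_unique[OF gh gen Y eqY _ that]) auto
  next
    case (2 M n n' a)
    interpret crossed_module S M n' a by unfold_locales (rule 2)
    have "n' (t x) = n' (t' x)" if "x \<in> carrier limit" for x
    proof -
      have "n ((n' \<circ> t) y) = n ((n' \<circ> t') y)" if "y \<in> carrier limit" for y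
        using 2(3)[OF hom_in_carrier[OF hom(1) that]] 2(3)[OF hom_in_carrier[OF hom(2) that]] t t' that
        by (metis o_apply)
      moreover have "n' \<circ> t \<in> hom limit M" "n' \<circ> t' \<in> hom limit M"
        using hom hom_compose n.homh by blast+
      ultimately show ?thesis
        using subnormal_series_lift_unique[OF 2(1) limit.is_group _ _ gen Y, of "n' \<circ> t" "n' \<circ> t'" x]
          eqY that by simp
    qed
    then show ?thesis by (intro lift_unique[OF gh gen Y eqY _ that]) auto
  qed
  then show "t = t'" using t t' by (intro extensionalityI) auto
qed

end

theorem theorem5:
  fixes \<Gamma> :: "'a monoid" and G :: "'g monoid" and \<phi> :: "'a \<Rightarrow> 'g"
    and T :: "nat \<Rightarrow> 'u monoid" and f :: "nat \<Rightarrow> 'a \<Rightarrow> 'u"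
    and p1 :: "'u \<Rightarrow> 'g" and p :: "nat \<Rightarrow> 'u \<Rightarrow> 'u"
  assumes "infinite (UNIV :: 'u set)"
    and "group \<Gamma>" and "finite (carrier \<Gamma>)"
    and "group G" and "finite (carrier G)"
    and "\<phi> \<in> hom \<Gamma> G"
    and "normal_closures_tower \<Gamma> G \<phi> T f p1 p"
  shows "tower_map \<phi> f \<in> hom \<Gamma> (tower_limit G T p1 p) \<and>
    (\<forall>\<gamma>\<in>carrier \<Gamma>. tower_proj (tower_map \<phi> f \<gamma>) = \<phi> \<gamma>) \<and>
    subnormal_map TYPE('u) (tower_limit G T p1 p) G tower_proj \<and>
    (\<forall>(S :: 's monoid) s \<psi>.
       group S \<and> subnormal_map TYPE('v) S G s \<and> \<psi> \<in> hom \<Gamma> S \<and>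
       (\<forall>\<gamma>\<in>carrier \<Gamma>. s (\<psi> \<gamma>) = \<phi> \<gamma>) \<longrightarrow>
       (\<exists>!t. t \<in> extensional (carrier (tower_limit G T p1 p)) \<and>
             t \<in> hom (tower_limit G T p1 p) S \<and>
             (\<forall>\<gamma>\<in>carrier \<Gamma>. t (tower_map \<phi> f \<gamma>) = \<psi> \<gamma>) \<and>
             (\<forall>x\<in>carrier (tower_limit G T p1 p). s (t x) = tower_proj x)))"
proof -
  interpret closure_tower \<Gamma> G \<phi> T f p1 p
    using assms by (rule closure_tower.intro)
  show ?thesis
  proof (intro conjI ballI allI impI)
    show "tower_map \<phi> f \<in> hom \<Gamma> (tower_limit G T p1 p)" by (rule tower_map_hom)
    show "tower_proj (tower_map \<phi> f \<gamma>) = \<phi> \<gamma>" for \<gamma>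
      by (simp add: tower_proj_def tower_map_def)
    show "subnormal_map TYPE('u) (tower_limit G T p1 p) G tower_proj" by (rule subnormal_map_limit)
  qed (rule limit_universal, blast+)
qed

end
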